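(* There exist constants $C_0,c_1>0$ and absolute constants $0<c\le C<\infty$ such that the following holds. Suppose $n\ge2$, $0<q<1$ and $\pi\sim\mu_{n,q}$. (i) $c\,b_{n,q}\le \mathbb{E}(\mathrm{LDS}(\pi))\le C\,b_{n,q}$, where $$b_{n,q}=\begin{cases}\dfrac{1}{\sqrt{1-q}} & \text{if } 1-\frac{C_0}{(\log n)^2}\le q\le 1-\frac4n,\\[1em] \dfrac{\log n}{\log((1-q)(\log n)^2)} & \text{if } 1-\frac{c_1(\log\log n)^2}{\log n}\le q\le 1-\frac{C_0}{(\log n)^2},\\[1em] \sqrt{\dfrac{\log n}{\log(1/q)}} & \text{if } \frac1n\le q\le 1-\frac{c_1(\log\log n)^2}{\log n}.\end{cases}$$ (ii) If $0<q\le \frac1n$ then $c\,nq\le \mathbb{E}(\mathrm{LDS}(\pi))-1\le C\,nq$.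
   Context: For $q>0$ and an integer $n\ge1$, the Mallows measure $\mu_{n,q}$ on $S_n$ is $\mu_{n,q}(\pi)=q^{\mathrm{inv}(\pi)}/Z_{n,q}$, where $\mathrm{inv}(\pi)$ is the number of pairs $i<j$ with $\pi(i)>\pi(j)$ and $Z_{n,q}$ is the normalizing constant. $\mathrm{LDS}(\pi)$ denotes the length of a longest decreasing subsequence of $\pi$, i.e. the maximal $m$ with indices $i_1<\dots<i_m$ such that $\pi(i_1)>\dots>\pi(i_m)$. *)

theory Defs
  imports Complex_Main "HOL-Combinatorics.Permutations"
begin

definition inv_count :: "nat \<Rightarrow> (nat \<Rightarrow> nat) \<Rightarrow> nat" where
  "inv_count n p = card {(i, j). i \<in> {1..n} \<and> j \<in> {1..n} \<and> i < j \<and> p i > p j}"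

definition LDS :: "nat \<Rightarrow> (nat \<Rightarrow> nat) \<Rightarrow> nat" where
  "LDS n p = Max {card I | I. I \<subseteq> {1..n} \<and> (\<forall>i\<in>I. \<forall>j\<in>I. i < j \<longrightarrow> p i > p j)}"

definition mallows_Z :: "nat \<Rightarrow> real \<Rightarrow> real" where
  "mallows_Z n q = (\<Sum>p\<in>{p. p permutes {1..n}}. q ^ inv_count n p)"

definition mallows :: "nat \<Rightarrow> real \<Rightarrow> (nat \<Rightarrow> nat) \<Rightarrow> real" where
  "mallows n q p = q ^ inv_count n p / mallows_Z n q"

definition expected_LDS :: "nat \<Rightarrow> real \<Rightarrow> real" where
  "expected_LDS n q = (\<Sum>p\<in>{p. p permutes {1..n}}. mallows n q p * real (LDS n p))"

end

theory Submission
  imports Defs "HOL-Library.FuncSet" "HOL-Library.Disjoint_Sets"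
    "HOL-Analysis.Complex_Transcendental" "HOL-Real_Asymp.Real_Asymp"
begin

text \<open>The code \<open>a\<^sub>i = #{j < i. \<pi> j > \<pi> i}\<close> turns a Mallows permutation into independent truncated
  geometric variables. Revealing the positions from left to right, an entry exceeded by \<open>r\<close> of the
  revealed entries lies above the next entry \<open>i\<close> iff \<open>a\<^sub>i > r\<close>, and otherwise \<open>r\<close> grows by one.

  Upper bounds: the expected number of ways to prolong a decreasing subsequence by \<open>m\<close> entries is
  dominated by an explicit function of \<open>r\<close> satisfying the corresponding recursive inequality; the
  truncation of the geometric variables cancels in it. Hence the expected number of decreasing
  subsequences of length \<open>m + 1\<close> is at most \<open>n / (1 - q)\<close> times each of \<open>(16 / (1 - q))^m / (m!)\<^sup>2\<close>
  and \<open>q^(m (m + 1) / 2) / (1 - q)^(2 m)\<close>. The first bound is used for \<open>q\<close> close to 1, the second for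
  the other \<open>q \<ge> 1 / n\<close>.

  Lower bounds: cut time into blocks of \<open>\<tau>\<close> consecutive positions and call the \<open>j\<close>-th block
  successful if some code value in it lies in \<open>[3 \<tau> j, 3 \<tau> j + \<tau>)\<close>. A rank grows by at most one per
  step, so picking one such position from every successful block gives a decreasing subsequence.
  With \<open>\<tau> m \<approx> 1 / (1 - q)\<close> and \<open>m \<approx> 1 / \<surd>(1 - q)\<close> a positive fraction of \<open>m\<close> blocks succeeds; for
  larger \<open>m\<close> one repeats the experiment on many disjoint stretches until all \<open>m\<close> blocks succeed.\<close>

section \<open>Independent truncated geometric variables\<close>

definition geo :: "real \<Rightarrow> nat \<Rightarrow> nat \<Rightarrow> real" where
  "geo q i k = q ^ k / (\<Sum>j<i. q ^ j)"

text \<open>Expectation under independent coordinates with laws \<open>geo q i\<close>. Codes in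
  \<open>PiE\<close> are \<open>undefined\<close> off \<open>I\<close>, so passing from one index
  set to another needs a statement that \<open>g\<close> looks only at certain coordinates.\<close>

definition code_expect :: "real \<Rightarrow> nat set \<Rightarrow> ((nat \<Rightarrow> nat) \<Rightarrow> real) \<Rightarrow> real" where
  "code_expect q I g = (\<Sum>a\<in>PiE I (\<lambda>i. {..<i}). (\<Prod>i\<in>I. geo q i (a i)) * g a)"

text \<open>Quantified over all functions, also those outside \<open>PiE\<close>, so that dependence
  is stable under \<open>fun_upd\<close> and can be used with any index set.\<close>

definition depends_on :: "((nat \<Rightarrow> nat) \<Rightarrow> real) \<Rightarrow> nat set \<Rightarrow> bool" where
  "depends_on g I \<longleftrightarrow> (\<forall>a b. (\<forall>i\<in>I. a i = b i) \<longrightarrow> g a = g b)"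

lemma geo_nonneg: "0 \<le> q \<Longrightarrow> 0 \<le> geo q i k"
  by (simp add: geo_def sum_nonneg)

lemma geo_denom_pos:
  fixes q :: real
  assumes "0 < q" "0 < i"
  shows "0 < (\<Sum>j<i. q ^ j)"
  using assms by (intro sum_pos) auto

lemma sum_geo: "0 < q \<Longrightarrow> 0 < i \<Longrightarrow> (\<Sum>k<i. geo q i k) = 1"
  using geo_denom_pos[of q i] by (simp add: geo_def flip: sum_divide_distrib)

lemma code_expect_empty: "code_expect q {} g = g (\<lambda>_. undefined)"
  by (simp add: code_expect_def)

text \<open>Fubini: the coordinate \<open>i\<close> is split off through the bijection between pairs
  \<open>(k, f)\<close> and \<open>f(i := k)\<close>. All inductions on index sets rest on
  this.\<close>

lemma code_expect_insert:
  assumes "finite I" "i \<notin> I"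
  shows "code_expect q (insert i I) g = (\<Sum>k<i. geo q i k * code_expect q I (\<lambda>a. g (a(i := k))))"
proof -
  let ?S = "\<lambda>i::nat. {..<i}"
  have *: "(\<Prod>j\<in>insert i I. geo q j ((f(i := k)) j)) = geo q i k * (\<Prod>j\<in>I. geo q j (f j))" for f k
  proof -
    have "(\<Prod>j\<in>I. geo q j ((f(i := k)) j)) = (\<Prod>j\<in>I. geo q j (f j))"
      using assms by (intro prod.cong) auto
    then show ?thesis using assms by simp
  qed
  have "code_expect q (insert i I) g =
      (\<Sum>(k, f)\<in>?S i \<times> PiE I ?S. (\<Prod>j\<in>insert i I. geo q j ((f(i := k)) j)) * g (f(i := k)))"
    unfolding code_expect_def PiE_insert_eq
    by (subst sum.reindex) (use inj_combinator[OF assms(2)] in \<open>auto simp: case_prod_unfold\<close>)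
  also have "\<dots> = (\<Sum>(k, f)\<in>?S i \<times> PiE I ?S. geo q i k * ((\<Prod>j\<in>I. geo q j (f j)) * g (f(i := k))))"
    by (simp only: * mult.assoc)
  also have "\<dots> = (\<Sum>k<i. geo q i k * code_expect q I (\<lambda>a. g (a(i := k))))"
    by (simp add: code_expect_def sum_distrib_left sum.cartesian_product)
  finally show ?thesis .
qed

lemma code_expect_mono:
  assumes "0 \<le> q" "\<And>a. a \<in> PiE I (\<lambda>i. {..<i}) \<Longrightarrow> g a \<le> h a"
  shows "code_expect q I g \<le> code_expect q I h"
  unfolding code_expect_def using assms
  by (intro sum_mono mult_left_mono prod_nonneg) (auto simp: geo_nonneg)

lemma code_expect_add: "code_expect q I (\<lambda>a. g a + h a) = code_expect q I g + code_expect q I h"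
  by (simp add: code_expect_def algebra_simps sum.distrib)

lemma code_expect_cmult: "code_expect q I (\<lambda>a. c * g a) = c * code_expect q I g"
  by (simp add: code_expect_def algebra_simps sum_distrib_left)

lemma code_expect_sum:
  "code_expect q I (\<lambda>a. \<Sum>k\<in>K. g k a) = (\<Sum>k\<in>K. code_expect q I (g k))"
  unfolding code_expect_def sum_distrib_left by (rule sum.swap)

text \<open>Every \<open>geo q i\<close> with \<open>i > 0\<close> has total mass 1. The index 0 is
  excluded because its range \<open>{..<0}\<close> is empty and carries no mass.\<close>

lemma code_expect_const:
  assumes "0 < q" "finite I" "0 \<notin> I"
  shows "code_expect q I (\<lambda>_. c) = c"
  using assms(2,3)
proof (induction I rule: finite_induct)
  case empty
  then show ?case by (simp add: code_expect_empty)
next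
  case (insert i I)
  then show ?case using sum_geo[of q i] assms(1)
    by (simp add: code_expect_insert flip: sum_distrib_right)
qed

lemma code_expect_diff: "code_expect q I (\<lambda>a. g a - h a) = code_expect q I g - code_expect q I h"
  by (simp add: code_expect_def algebra_simps sum_subtractf)

text \<open>Induction on \<open>I\<close>: summing out a coordinate \<open>i\<close> of
  \<open>I\<close> leaves \<open>h\<close> untouched, as \<open>i\<close> is not in
  \<open>J\<close>, and keeps the dependence of \<open>g\<close> within the smaller set.\<close>

lemma code_expect_indep:
  assumes "finite I" "finite J" "I \<inter> J = {}" "depends_on g I" "depends_on h J"
  shows "code_expect q (I \<union> J) (\<lambda>a. g a * h a) = code_expect q I g * code_expect q J h"
  using assms(1,3,4)
proof (induction I arbitrary: g rule: finite_induct)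
  case empty
  then have "g a = g (\<lambda>_. undefined)" for a by (auto simp: depends_on_def)
  then have "(\<lambda>a. g a * h a) = (\<lambda>a. g (\<lambda>_. undefined) * h a)" by metis
  then show ?case by (simp add: code_expect_cmult code_expect_empty)
next
  case (insert i I)
  have h: "h (a(i := k)) = h a" for a k
    using assms(5) insert.prems by (auto simp: depends_on_def)
  have g: "depends_on (\<lambda>a. g (a(i := k))) I" for k
    using insert.prems by (auto simp: depends_on_def)
  have "code_expect q (insert i I \<union> J) (\<lambda>a. g a * h a) =
      (\<Sum>k<i. geo q i k * (code_expect q I (\<lambda>a. g (a(i := k))) * code_expect q J h))"
    using insert g assms(2) by (simp add: code_expect_insert h)
  also have "\<dots> = code_expect q (insert i I) g * code_expect q J h"
    using insert by (simp add: code_expect_insert sum_distrib_right mult.assoc)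
  finally show ?case .
qed

text \<open>The surplus coordinates \<open>I - J\<close> are integrated out as an independent
  factor, the constant 1.\<close>

lemma code_expect_superset:
  assumes "0 < q" "finite I" "0 \<notin> I" "J \<subseteq> I" "depends_on g J"
  shows "code_expect q I g = code_expect q J g"
proof -
  have "J \<union> (I - J) = I" using assms by auto
  then show ?thesis
    using code_expect_indep[of J "I - J" g "\<lambda>_. 1" q] assms finite_subset[of J I]
    by (auto simp: depends_on_def code_expect_const)
qed

lemma depends_on_prod:
  assumes "\<And>k. k \<in> K \<Longrightarrow> depends_on (g k) (B k)"
  shows "depends_on (\<lambda>a. \<Prod>k\<in>K. g k a) (\<Union>k\<in>K. B k)"
  using assms unfolding depends_on_def by (metis (no_types, lifting) UN_iff prod.cong)

lemma code_expect_prod: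
  assumes "finite K" "\<And>k. k \<in> K \<Longrightarrow> finite (B k)" "disjoint_family_on B K"
    "\<And>k. k \<in> K \<Longrightarrow> depends_on (g k) (B k)"
  shows "code_expect q (\<Union>k\<in>K. B k) (\<lambda>a. \<Prod>k\<in>K. g k a) = (\<Prod>k\<in>K. code_expect q (B k) (g k))"
  using assms
proof (induction K rule: finite_induct)
  case empty
  then show ?case by (simp add: code_expect_empty)
next
  case (insert k K)
  have "B k \<inter> (\<Union>j\<in>K. B j) = {}"
    using insert.prems(2) insert.hyps by (auto simp: disjoint_family_on_def)
  then have "code_expect q (B k \<union> (\<Union>j\<in>K. B j)) (\<lambda>a. g k a * (\<Prod>j\<in>K. g j a)) =
      code_expect q (B k) (g k) * code_expect q (\<Union>j\<in>K. B j) (\<lambda>a. \<Prod>j\<in>K. g j a)"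
    using insert by (intro code_expect_indep depends_on_prod) auto
  moreover have "disjoint_family_on B K"
    using insert.prems(2) by (auto simp: disjoint_family_on_def)
  ultimately show ?case using insert by simp
qed

section \<open>Inversion codes\<close>

text \<open>\<open>rk a i d\<close> is the number of the entries at positions up to \<open>i + d\<close> that exceed the entry at
  position \<open>i\<close>, computed from the inversion code \<open>a\<close>.\<close>

primrec rk :: "(nat \<Rightarrow> nat) \<Rightarrow> nat \<Rightarrow> nat \<Rightarrow> nat" where
  "rk a i 0 = a i"
| "rk a i (Suc d) = (if a (i + Suc d) \<le> rk a i d then Suc (rk a i d) else rk a i d)"

text \<open>\<open>rk a i (j - 1 - i)\<close> is the rank of entry \<open>i\<close> just before
  position \<open>j\<close> is revealed. Entry \<open>j\<close> comes out below entry
  \<open>i\<close> exactly when its code value exceeds that rank.\<close>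

definition dec_chain :: "(nat \<Rightarrow> nat) \<Rightarrow> nat set \<Rightarrow> bool" where
  "dec_chain a I \<longleftrightarrow> (\<forall>i\<in>I. \<forall>j\<in>I. i < j \<longrightarrow> rk a i (j - 1 - i) < a j)"

definition code_LDS :: "nat \<Rightarrow> (nat \<Rightarrow> nat) \<Rightarrow> nat" where
  "code_LDS n a = Max {card I | I. I \<subseteq> {1..n} \<and> dec_chain a I}"

text \<open>The restriction makes codes extensional, hence points of the product space over which
  \<open>code_expect\<close> sums.\<close>

definition inv_code :: "nat \<Rightarrow> (nat \<Rightarrow> nat) \<Rightarrow> nat \<Rightarrow> nat" where
  "inv_code n p = restrict (\<lambda>i. card {j \<in> {1..<i}. p j > p i}) {1..n}"

section \<open>Codes and the relative order of entries\<close>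

text \<open>The two sets of exceeding positions before \<open>j\<close> are nested according to the
  order of \<open>p i\<close> and \<open>p j\<close>. If \<open>p j < p i\<close> the inclusion is
  strict, because \<open>i\<close> itself exceeds \<open>p j\<close>.\<close>

lemma less_iff_rank:
  fixes p :: "nat \<Rightarrow> nat"
  assumes "inj p" "1 \<le> i" "i < j"
  shows "p j < p i \<longleftrightarrow> card {k \<in> {1..<j}. p k > p i} < card {k \<in> {1..<j}. p k > p j}"
proof
  assume "p j < p i"
  then have "{k \<in> {1..<j}. p k > p i} \<subset> {k \<in> {1..<j}. p k > p j}"
    using assms by auto
  then show "card {k \<in> {1..<j}. p k > p i} < card {k \<in> {1..<j}. p k > p j}"
    by (intro psubset_card_mono) auto
next
  assume *: "card {k \<in> {1..<j}. p k > p i} < card {k \<in> {1..<j}. p k > p j}"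
  show "p j < p i"
  proof (rule ccontr)
    assume "\<not> p j < p i"
    then have "{k \<in> {1..<j}. p k > p j} \<subseteq> {k \<in> {1..<j}. p k > p i}" by auto
    then have "card {k \<in> {1..<j}. p k > p j} \<le> card {k \<in> {1..<j}. p k > p i}"
      by (intro card_mono) auto
    with * show False by simp
  qed
qed

text \<open>Induction on \<open>d\<close>: by \<open>less_iff_rank\<close>, the test in the
  recursion for \<open>rk\<close> decides whether the newly revealed entry lies above entry
  \<open>i\<close>, and only then does the count grow.\<close>

lemma rk_inv_code:
  assumes "inj p" "1 \<le> i" "i + d \<le> n"
  shows "rk (inv_code n p) i d = card {k \<in> {1..i + d}. p k > p i}"
  using assms(3)
proof (induction d)
  case 0
  have "{k \<in> {1..i}. p k > p i} = {j \<in> {1..<i}. p j > p i}"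
    by (auto simp: order_le_less)
  with 0 assms show ?case by (simp add: inv_code_def)
next
  case (Suc d)
  let ?j = "i + Suc d"
  have eq: "{1..<?j} = {1..i + d}" by auto
  have "inv_code n p ?j = card {k \<in> {1..<?j}. p k > p ?j}"
    using Suc.prems assms(2) by (simp add: inv_code_def)
  moreover have IH: "rk (inv_code n p) i d = card {k \<in> {1..<?j}. p k > p i}"
    using Suc unfolding eq by simp
  ultimately have iff: "inv_code n p ?j \<le> rk (inv_code n p) i d \<longleftrightarrow> p ?j > p i"
    using less_iff_rank[OF assms(1,2), of ?j] inj_eq[OF assms(1), of i ?j]
    by auto
  have ins: "{1..?j} = insert ?j {1..<?j}" by auto
  have "{k \<in> {1..?j}. p k > p i} =
      (if p ?j > p i then insert ?j {k \<in> {1..<?j}. p k > p i} else {k \<in> {1..<?j}. p k > p i})"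
    unfolding ins by auto
  then show ?case using iff IH by simp
qed

lemma less_iff_inv_code:
  assumes "inj p" "1 \<le> i" "i < j" "j \<le> n"
  shows "p j < p i \<longleftrightarrow> rk (inv_code n p) i (j - 1 - i) < inv_code n p j"
proof -
  have "{1..i + (j - 1 - i)} = {1..<j}" using assms by auto
  then show ?thesis
    using less_iff_rank[OF assms(1-3)] rk_inv_code[OF assms(1,2), of "j - 1 - i" n] assms
    by (simp add: inv_code_def)
qed

lemma LDS_eq_code_LDS:
  assumes "inj p"
  shows "LDS n p = code_LDS n (inv_code n p)"
proof -
  have "(I \<subseteq> {1..n} \<and> (\<forall>i\<in>I. \<forall>j\<in>I. i < j \<longrightarrow> p i > p j)) \<longleftrightarrow> (I \<subseteq> {1..n} \<and> dec_chain (inv_code n p) I)" for I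
    unfolding dec_chain_def using less_iff_inv_code[OF assms, of _ _ n] by (metis atLeastAtMost_iff subsetD)
  then show ?thesis unfolding LDS_def code_LDS_def by simp
qed

text \<open>A value is one more than the number of smaller values, so the relative order determines
  the permutation.\<close>

lemma permutes_eqI_order:
  fixes p p' :: "nat \<Rightarrow> nat"
  assumes p: "p permutes {1..n}" and p': "p' permutes {1..n}"
    and ord: "\<And>i j. i \<in> {1..n} \<Longrightarrow> j \<in> {1..n} \<Longrightarrow> p j < p i \<longleftrightarrow> p' j < p' i"
  shows "p = p'"
proof
  fix i
  have count: "r i = card {j \<in> {1..n}. r j < r i} + 1" if r: "r permutes {1..n}" and i: "i \<in> {1..n}" for r :: "nat \<Rightarrow> nat"
  proof -
    have "r ` {j \<in> {1..n}. r j < r i} = {1..<r i}"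
    proof -
      have "r ` {1..n} = {1..n}" using r by (rule permutes_image)
      moreover have "r i \<le> n" using r i permutes_in_image by fastforce
      moreover have "y \<in> r ` {j \<in> {1..n}. r j < r i}" if "y \<in> {1..<r i}" for y
      proof -
        have "y \<in> r ` {1..n}" using that calculation by simp
        then show ?thesis using that by auto
      qed
      moreover have "1 \<le> r j" if "j \<in> {1..n}" for j
        using that r permutes_in_image by fastforce
      ultimately show ?thesis by auto
    qed
    then have "card {j \<in> {1..n}. r j < r i} = r i - 1"
      using card_image[of r "{j \<in> {1..n}. r j < r i}"] r
      by (metis card_atLeastLessThan inj_on_subset permutes_inj top_greatest)
    moreover have "1 \<le> r i" using r i permutes_in_image by fastforce
    ultimately show ?thesis by simp
  qed
  show "p i = p' i"
  proof (cases "i \<in> {1..n}")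
    case True
    then have "{j \<in> {1..n}. p j < p i} = {j \<in> {1..n}. p' j < p' i}" using ord by auto
    then show ?thesis using count[OF p True] count[OF p' True] by simp
  next
    case False
    then show ?thesis using p p' by (simp add: permutes_not_in)
  qed
qed

text \<open>Injective since the code decides every comparison of two entries. Onto by counting,
  since both sides have \<open>fact n\<close> elements.\<close>

lemma bij_betw_inv_code:
  "bij_betw (inv_code n) {p. p permutes {1..n}} (PiE {1..n} (\<lambda>i. {..<i}))"
proof -
  have inj: "inj_on (inv_code n) {p. p permutes {1..n}}"
  proof (rule inj_onI, clarify)
    fix p p' assume p: "p permutes {1..n}" and p': "p' permutes {1..n}" and eq: "inv_code n p = inv_code n p'"
    have *: "p j < p i \<longleftrightarrow> p' j < p' i" if "1 \<le> i" "i < j" "j \<le> n" for i j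
      using less_iff_inv_code[of p i j n] less_iff_inv_code[of p' i j n] that eq permutes_inj p p' by auto
    show "p = p'"
    proof (rule permutes_eqI_order[OF p p'])
      fix i j assume i: "i \<in> {1..n}" and j: "j \<in> {1..n}"
      have ne: "p x \<noteq> p y" "p' x \<noteq> p' y" if "x \<noteq> y" for x y
        using that permutes_inj[OF p] permutes_inj[OF p'] by (auto dest: injD)
      consider "i < j" | "i = j" | "j < i" by linarith
      then show "p j < p i \<longleftrightarrow> p' j < p' i"
      proof cases
        case 3
        then show ?thesis using *[of j i] i j ne[of i j] by auto
      qed (use * i j in auto)
    qed
  qed
  have "inv_code n p \<in> PiE {1..n} (\<lambda>i. {..<i})" for p
  proof -
    have "card {j \<in> {1..<i}. p j > p i} < i" if "1 \<le> i" for i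
    proof -
      have "card {j \<in> {1..<i}. p j > p i} \<le> card {1..<i}" by (intro card_mono) auto
      then show ?thesis using that by simp
    qed
    then show ?thesis by (auto simp: inv_code_def PiE_def Pi_def)
  qed
  then have sub: "inv_code n ` {p. p permutes {1..n}} \<subseteq> PiE {1..n} (\<lambda>i. {..<i})" by auto
  have "card (PiE {1..n} (\<lambda>i. {..<i})) = fact n"
    by (simp add: card_PiE fact_prod)
  moreover have "card {p. p permutes {1..n}} = fact n"
    by (simp add: card_permutations)
  ultimately have "inv_code n ` {p. p permutes {1..n}} = PiE {1..n} (\<lambda>i. {..<i})"
    using sub inj by (intro card_subset_eq finite_PiE) (auto simp: card_image)
  then show ?thesis using inj by (simp add: bij_betw_def)
qed

section \<open>The Mallows law in code coordinates\<close>

text \<open>Inversions are grouped by their right end.\<close>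

lemma inv_count_eq_sum_code: "inv_count n p = (\<Sum>i\<in>{1..n}. inv_code n p i)"
proof -
  have "{(i, j). i \<in> {1..n} \<and> j \<in> {1..n} \<and> i < j \<and> p i > p j} =
      prod.swap ` (SIGMA j:{1..n}. {i \<in> {1..<j}. p i > p j})"
    by (auto simp: image_iff)
  then have "inv_count n p = card (SIGMA j:{1..n}. {i \<in> {1..<j}. p i > p j})"
    unfolding inv_count_def by (simp add: card_image)
  also have "\<dots> = (\<Sum>j\<in>{1..n}. card {i \<in> {1..<j}. p i > p j})"
    by (rule card_SigmaI) auto
  also have "\<dots> = (\<Sum>i\<in>{1..n}. inv_code n p i)"
    by (intro sum.cong) (auto simp: inv_code_def)
  finally show ?thesis .
qed

lemma mallows_Z_eq: "mallows_Z n q = (\<Prod>i\<in>{1..n}. \<Sum>k<i. q ^ k)"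
proof -
  have "mallows_Z n q = (\<Sum>p\<in>{p. p permutes {1..n}}. \<Prod>i\<in>{1..n}. q ^ inv_code n p i)"
    by (simp add: mallows_Z_def inv_count_eq_sum_code power_sum)
  also have "\<dots> = (\<Sum>a\<in>PiE {1..n} (\<lambda>i. {..<i}). \<Prod>i\<in>{1..n}. q ^ a i)"
    by (rule sum.reindex_bij_betw[OF bij_betw_inv_code])
  also have "\<dots> = (\<Prod>i\<in>{1..n}. \<Sum>k<i. q ^ k)"
    by (rule prod_sum_PiE[symmetric]) auto
  finally show ?thesis .
qed

text \<open>Both \<open>q ^ inv_count n p\<close> and the normalizing constant are products over
  positions, so the code has independent coordinates of law \<open>geo q i\<close>.\<close>

lemma expected_LDS_eq: "expected_LDS n q = code_expect q {1..n} (\<lambda>a. real (code_LDS n a))"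
proof -
  have "expected_LDS n q = (\<Sum>p\<in>{p. p permutes {1..n}}.
      (\<Prod>i\<in>{1..n}. geo q i (inv_code n p i)) * real (code_LDS n (inv_code n p)))"
    unfolding expected_LDS_def
  proof (intro sum.cong refl)
    fix p assume "p \<in> {p. p permutes {1..n}}"
    then have "inj p" by (auto intro: permutes_inj)
    then show "mallows n q p * real (LDS n p) =
        (\<Prod>i\<in>{1..n}. geo q i (inv_code n p i)) * real (code_LDS n (inv_code n p))"
      by (simp add: LDS_eq_code_LDS mallows_def mallows_Z_eq inv_count_eq_sum_code power_sum geo_def prod_dividef)
  qed
  also have "\<dots> = code_expect q {1..n} (\<lambda>a. real (code_LDS n a))"
    unfolding code_expect_def by (rule sum.reindex_bij_betw[OF bij_betw_inv_code])
  finally show ?thesis .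
qed

lemma finite_code_LDS_set: "finite {card I | I. I \<subseteq> {1..n} \<and> dec_chain a I}"
proof -
  have "{card I | I. I \<subseteq> {1..n} \<and> dec_chain a I} \<subseteq> card ` Pow {1..n}" by auto
  then show ?thesis by (rule finite_subset) simp
qed

lemma card_le_code_LDS: "I \<subseteq> {1..n} \<Longrightarrow> dec_chain a I \<Longrightarrow> card I \<le> code_LDS n a"
  unfolding code_LDS_def by (intro Max_ge finite_code_LDS_set) auto

lemma code_LDS_witness: "\<exists>I. I \<subseteq> {1..n} \<and> dec_chain a I \<and> card I = code_LDS n a"
proof -
  have "dec_chain a {}" by (simp add: dec_chain_def)
  then have "{card I | I. I \<subseteq> {1..n} \<and> dec_chain a I} \<noteq> {}" by blast
  from Max_in[OF finite_code_LDS_set this] show ?thesis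
    unfolding code_LDS_def by auto
qed

lemma dec_chain_subset: "dec_chain a I \<Longrightarrow> J \<subseteq> I \<Longrightarrow> dec_chain a J"
  by (auto simp: dec_chain_def)

lemma code_LDS_witness_le:
  assumes "m \<le> code_LDS n a"
  obtains I where "I \<subseteq> {1..n}" "dec_chain a I" "card I = m"
proof -
  obtain J where J: "J \<subseteq> {1..n}" "dec_chain a J" "card J = code_LDS n a"
    using code_LDS_witness by blast
  then obtain I where "I \<subseteq> J" "card I = m"
    using assms obtain_subset_with_card_n[of m J] by metis
  then show thesis using that[of I] J dec_chain_subset by blast
qed

lemma code_LDS_le: "code_LDS n a \<le> n"
proof -
  obtain I where "I \<subseteq> {1..n}" "card I = code_LDS n a" using code_LDS_witness by blast
  then show ?thesis using card_mono[of "{1..n}" I] by simp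
qed

lemma code_LDS_ge_1: "1 \<le> n \<Longrightarrow> 1 \<le> code_LDS n a"
  using card_le_code_LDS[of "{1}" n a] by (simp add: dec_chain_def)

section \<open>The upper bound: counting decreasing subsequences\<close>

text \<open>The decreasing subsequences within the first \<open>n\<close> positions, each recorded by its length and
  by the number of entries among the first \<open>n\<close> that exceed its last entry.\<close>

primrec chain_profile :: "(nat \<Rightarrow> nat) \<Rightarrow> nat \<Rightarrow> (nat \<times> nat) list" where
  "chain_profile a 0 = []"
| "chain_profile a (Suc n) =
    map (\<lambda>(l, r). (l, if a (Suc n) \<le> r then Suc r else r)) (chain_profile a n) @
    map (\<lambda>(l, r). (Suc l, a (Suc n))) (filter (\<lambda>(l, r). r < a (Suc n)) (chain_profile a n)) @
    [(1, a (Suc n))]"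

lemma chains_cong: "(\<And>i. i \<in> {1..n} \<Longrightarrow> a i = b i) \<Longrightarrow> chain_profile a n = chain_profile b n"
proof (induction n)
  case (Suc n)
  then have "chain_profile a n = chain_profile b n" "a (Suc n) = b (Suc n)" by auto
  then show ?case by simp
qed simp

text \<open>Induction on \<open>n\<close>. If the new position is not in \<open>I\<close>, only the
  rank is updated. Otherwise it is the last entry of \<open>I\<close>, and the chain condition
  against the previous last entry is the filter condition for prolonging
  \<open>I - {Suc n}\<close>.\<close>

lemma chain_in_chains:
  assumes "I \<subseteq> {1..n}" "I \<noteq> {}" "dec_chain a I"
  shows "(card I, rk a (Max I) (n - Max I)) \<in> set (chain_profile a n)"
  using assms
proof (induction n arbitrary: I)
  case 0
  then show ?case by simp
next
  case (Suc n)
  have fin: "finite I" using Suc.prems(1) finite_subset by blast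
  show ?case
  proof (cases "Suc n \<in> I")
    case False
    then have I: "I \<subseteq> {1..n}" using Suc.prems(1) by (auto simp: le_Suc_eq)
    have "Max I \<le> n" using Max_in[OF fin Suc.prems(2)] I by auto
    then have "Suc n - Max I = Suc (n - Max I)" "Max I + Suc (n - Max I) = Suc n" by auto
    then show ?thesis using Suc.IH[OF I Suc.prems(2,3)]
      by (auto simp: image_iff intro!: bexI)
  next
    case True
    let ?J = "I - {Suc n}"
    have J: "?J \<subseteq> {1..n}" using Suc.prems(1) by (auto simp: le_Suc_eq)
    have mx: "Max I = Suc n"
      using fin True Suc.prems(1) by (intro Max_eqI) auto
    show ?thesis
    proof (cases "?J = {}")
      case True
      then have "I = {Suc n}" using \<open>Suc n \<in> I\<close> by auto
      then show ?thesis by simp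
    next
      case False
      have finJ: "finite ?J" using fin by simp
      have in_J: "Max ?J \<in> ?J" using Max_in[OF finJ False] .
      then have "Max ?J < Suc n" using J by fastforce
      then have "rk a (Max ?J) (n - Max ?J) < a (Suc n)"
        using Suc.prems(3) in_J True unfolding dec_chain_def by fastforce
      moreover have "(card ?J, rk a (Max ?J) (n - Max ?J)) \<in> set (chain_profile a n)"
        using Suc.IH[OF J False] dec_chain_subset[OF Suc.prems(3)] by blast
      moreover have "card I = Suc (card ?J)" using card.remove[OF fin True] .
      ultimately show ?thesis unfolding mx by (auto simp: image_iff intro!: bexI)
    qed
  qed
qed

text \<open>The terms follow the three sources of chains: an old one with updated rank, an old one
  prolonged by the new entry, and the new entry alone.\<close>

lemma sum_list_chains_Suc:
  fixes G :: "nat \<Rightarrow> nat \<Rightarrow> real" and a :: "nat \<Rightarrow> nat" and n :: nat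
  defines "x \<equiv> a (Suc n)"
  shows "(\<Sum>(l, r)\<leftarrow>chain_profile a (Suc n). G l r) =
    (\<Sum>(l, r)\<leftarrow>chain_profile a n. G l (if x \<le> r then Suc r else r) + (if r < x then G (Suc l) x else 0)) + G 1 x"
proof -
  have *: "sum_list (map (\<lambda>(l, r). G l r) (map (\<lambda>(l, r). (Suc l, x)) (filter (\<lambda>(l, r). r < x) xs))) =
      (\<Sum>(l, r)\<leftarrow>xs. if r < x then G (Suc l) x else 0)" for xs
    by (induction xs) auto
  have **: "sum_list (map (\<lambda>(l, r). G l r) (map (\<lambda>(l, r). (l, if x \<le> r then Suc r else r)) xs)) =
      (\<Sum>(l, r)\<leftarrow>xs. G l (if x \<le> r then Suc r else r))" for xs
    by (induction xs) auto
  have "(\<Sum>(l, r)\<leftarrow>xs. f l r + g l r) = (\<Sum>(l, r)\<leftarrow>xs. f l r) + (\<Sum>(l, r)\<leftarrow>xs. g l r :: real)" for f g and xs :: "(nat \<times> nat) list"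
    by (induction xs) auto
  then show ?thesis
    unfolding chain_profile.simps map_append sum_list_append x_def[symmetric] * ** by simp
qed

text \<open>\<open>G\<close> is a supersolution: on average over the next code value, a chain
  together with its prolongation weighs no more than the chain did before. The expected total weight
  therefore grows only through the one-entry chains born at each position.\<close>

lemma code_expect_chains_le:
  assumes q: "0 < q"
    and super: "\<And>T l r. T \<in> {1..n} \<Longrightarrow> (\<Sum>x<T. geo q T x *
      (G l (if x \<le> r then Suc r else r) + (if r < x then G (Suc l) x else 0))) \<le> G l r"
  shows "code_expect q {1..n} (\<lambda>a. \<Sum>(l, r)\<leftarrow>chain_profile a n. G l r) \<le> (\<Sum>i=1..n. \<Sum>k<i. geo q i k * G 1 k)"
  using super
proof (induction n)
  case 0
  then show ?case by (simp add: code_expect_empty)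
next
  case (Suc n)
  let ?T = "Suc n"
  let ?s = "\<lambda>x l r. G l (if x \<le> r then Suc r else r) + (if r < x then G (Suc l) x else 0)"
  \<comment> \<open>Averaging over the new code value is moved inside the sum over chains, so that
    the supersolution inequality can be applied to each chain separately.\<close>
  have lin: "(\<Sum>x<?T. geo q ?T x * ((\<Sum>(l, r)\<leftarrow>xs. ?s x l r) + G 1 x)) =
      (\<Sum>(l, r)\<leftarrow>xs. \<Sum>x<?T. geo q ?T x * ?s x l r) + (\<Sum>x<?T. geo q ?T x * G 1 x)" for xs
    by (induction xs) (simp_all add: algebra_simps sum.distrib case_prod_unfold)
  have ins: "{1..?T} = insert ?T {1..n}" by auto
  have c: "chain_profile (a(?T := k)) n = chain_profile a n" for a k by (rule chains_cong) auto
  have "code_expect q {1..?T} (\<lambda>a. \<Sum>(l, r)\<leftarrow>chain_profile a ?T. G l r) =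
      (\<Sum>x<?T. geo q ?T x * code_expect q {1..n} (\<lambda>a. (\<Sum>(l, r)\<leftarrow>chain_profile a n. ?s x l r) + G 1 x))"
    unfolding ins sum_list_chains_Suc
    by (subst code_expect_insert) (simp_all only: c fun_upd_same finite_atLeastAtMost, simp)
  also have "\<dots> = code_expect q {1..n} (\<lambda>a. \<Sum>x<?T. geo q ?T x * ((\<Sum>(l, r)\<leftarrow>chain_profile a n. ?s x l r) + G 1 x))"
    by (simp only: code_expect_sum code_expect_cmult)
  also have "\<dots> = code_expect q {1..n} (\<lambda>a. (\<Sum>(l, r)\<leftarrow>chain_profile a n. \<Sum>x<?T. geo q ?T x * ?s x l r) + (\<Sum>x<?T. geo q ?T x * G 1 x))"
    by (simp only: lin)
  also have "\<dots> \<le> code_expect q {1..n} (\<lambda>a. (\<Sum>(l, r)\<leftarrow>chain_profile a n. G l r) + (\<Sum>x<?T. geo q ?T x * G 1 x))"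
    using q Suc.prems[of ?T] by (intro code_expect_mono add_right_mono sum_list_mono) auto
  also have "\<dots> = code_expect q {1..n} (\<lambda>a. \<Sum>(l, r)\<leftarrow>chain_profile a n. G l r) + (\<Sum>x<?T. geo q ?T x * G 1 x)"
    using q by (simp only: code_expect_add) (simp add: code_expect_const)
  also have "\<dots> \<le> (\<Sum>i=1..?T. \<Sum>k<i. geo q i k * G 1 k)"
    using Suc by simp
  finally show ?case .
qed

text \<open>The expected number of ways to append \<open>m\<close> further entries to a decreasing subsequence
  whose last entry is exceeded by \<open>r\<close> entries is at most \<open>pot q N m r\<close>.\<close>

primrec pot :: "real \<Rightarrow> nat \<Rightarrow> nat \<Rightarrow> nat \<Rightarrow> real" where
  "pot q N 0 r = 1"
| "pot q N (Suc m) r = (\<Sum>s=r..N. (\<Sum>x=Suc s..N. q ^ x * (1 - q) * pot q N m x) / (1 - q ^ Suc s))"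

text \<open>The inner sum of \<open>pot\<close> as a function of its lower end. With
  \<open>R = 0\<close> it bounds, up to the normalization \<open>1 - q ^ i\<close>, the weight of a
  chain starting at position \<open>i\<close>.\<close>

definition pot_tail :: "real \<Rightarrow> nat \<Rightarrow> nat \<Rightarrow> nat \<Rightarrow> real" where
  "pot_tail q N m R = (\<Sum>x=R..N. q ^ x * (1 - q) * pot q N m x)"

lemma pot_Suc: "pot q N (Suc m) r = (\<Sum>s=r..N. pot_tail q N m (Suc s) / (1 - q ^ Suc s))"
  by (simp add: pot_tail_def)

lemma one_minus_power_pos: "0 < q \<Longrightarrow> q < 1 \<Longrightarrow> 0 < k \<Longrightarrow> 0 < 1 - (q::real) ^ k"
  using power_strict_decreasing[of 0 k q] by simp

lemma pot_nonneg:
  assumes "0 < q" "q < 1"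
  shows "0 \<le> pot q N m r"
proof (induction m arbitrary: r)
  case (Suc m)
  have "0 \<le> 1 - q ^ Suc s" for s using one_minus_power_pos[OF assms, of "Suc s"] by simp
  then show ?case using Suc assms unfolding pot.simps
    by (intro sum_nonneg divide_nonneg_nonneg mult_nonneg_nonneg) auto
qed simp

text \<open>Consecutive values differ by a single summand of the outer sum. This is the equality
  case of the condition on \<open>g\<close> and \<open>h\<close> in
  \<open>pot_supersolution\<close>. Beyond \<open>N\<close> both sides vanish.\<close>

lemma pot_step:
  assumes "0 < q" "q < 1"
  shows "(1 - q ^ Suc r) * (pot q N (Suc m) r - pot q N (Suc m) (Suc r)) = pot_tail q N m (Suc r)"
proof (cases "r \<le> N")
  case True
  then have "pot q N (Suc m) r = pot_tail q N m (Suc r) / (1 - q ^ Suc r) + pot q N (Suc m) (Suc r)"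
    unfolding pot_Suc by (subst sum.atLeast_Suc_atMost) auto
  then show ?thesis using one_minus_power_pos[OF assms, of "Suc r"] by (simp add: field_simps)
next
  case False
  then show ?thesis by (simp add: pot_tail_def)
qed

lemma geo_eq:
  assumes "0 < q" "q < 1"
  shows "geo q i k = q ^ k * (1 - q) / (1 - q ^ i)"
  using assms by (simp add: geo_def sum_gp_strict field_simps)

text \<open>Code values up to \<open>r\<close> raise the rank and have total mass
  \<open>(1 - q ^ Suc r) / (1 - q ^ T)\<close>; larger ones prolong the chain and carry the same
  denominator. The factor \<open>1 / (1 - q ^ T)\<close> cancels, which is why the condition on
  \<open>g\<close> and \<open>h\<close> does not mention \<open>T\<close>.\<close>

lemma pot_supersolution:
  assumes q: "0 < q" "q < 1" and T: "T \<in> {1..N}"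
    and G: "\<And>r. (1 - q ^ Suc r) * (g r - g (Suc r)) \<ge> (\<Sum>x=Suc r..N. q ^ x * (1 - q) * h x)"
    and h: "\<And>x. 0 \<le> h x"
  shows "(\<Sum>x<T. geo q T x * (g (if x \<le> r then Suc r else r) + (if r < x then h x else 0))) \<le> g r"
proof -
  have pos: "0 < 1 - q ^ T" using one_minus_power_pos[OF q, of T] T by simp
  have pr: "0 < 1 - q ^ Suc r" using one_minus_power_pos[OF q, of "Suc r"] by simp
  have "0 \<le> (\<Sum>x=Suc r..N. q ^ x * (1 - q) * h x)" using q h by (intro sum_nonneg) auto
  with G[of r] pr have dec: "g (Suc r) \<le> g r"
    by (smt (verit) mult_pos_neg)
  show ?thesis
  proof (cases "Suc r \<le> T")
    \<comment> \<open>Here every possible code value is at most \<open>r\<close>, so the rank rises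
      with certainty and monotonicity of \<open>g\<close> suffices.\<close>
    case False
    then have "(\<Sum>x<T. geo q T x * (g (if x \<le> r then Suc r else r) + (if r < x then h x else 0))) = (\<Sum>x<T. geo q T x * g (Suc r))"
      by (intro sum.cong) auto
    also have "\<dots> = g (Suc r)" using sum_geo[of q T] q T by (simp flip: sum_distrib_right)
    finally show ?thesis using dec by simp
  next
    case True
    then have split: "{..<T} = {..<Suc r} \<union> {Suc r..<T}" by auto
    have "(\<Sum>x<T. geo q T x * (g (if x \<le> r then Suc r else r) + (if r < x then h x else 0))) =
        (\<Sum>x<T. geo q T x * g r + (if x < Suc r then geo q T x * (g (Suc r) - g r) else geo q T x * h x))"
      by (intro sum.cong) (auto simp: algebra_simps)
    also have "\<dots> = g r + (\<Sum>x<T. if x < Suc r then geo q T x * (g (Suc r) - g r) else geo q T x * h x)"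
      using sum_geo[of q T] q T by (simp add: sum.distrib flip: sum_distrib_right)
    also have "(\<Sum>x<T. if x < Suc r then geo q T x * (g (Suc r) - g r) else geo q T x * h x) =
        (\<Sum>x<Suc r. geo q T x) * (g (Suc r) - g r) + (\<Sum>x=Suc r..<T. geo q T x * h x)"
      unfolding split by (subst sum.union_disjoint) (auto simp: sum_distrib_right distrib_right)
    also have "(\<Sum>x<Suc r. geo q T x) = (1 - q ^ Suc r) / (1 - q ^ T)"
    proof -
      have "(1 - q) * (\<Sum>x<Suc r. q ^ x) = 1 - q ^ Suc r"
        by (rule one_diff_power_eq[symmetric])
      then show ?thesis using q
        by (simp only: geo_eq sum_divide_distrib[symmetric] sum_distrib_right[symmetric]) (simp add: mult.commute)
    qed
    also have "(\<Sum>x=Suc r..<T. geo q T x * h x) = (\<Sum>x=Suc r..<T. q ^ x * (1 - q) * h x) / (1 - q ^ T)"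
      using q by (simp add: geo_eq sum_divide_distrib)
    finally have eq: "(\<Sum>x<T. geo q T x * (g (if x \<le> r then Suc r else r) + (if r < x then h x else 0))) =
        g r + ((1 - q ^ Suc r) / (1 - q ^ T) * (g (Suc r) - g r) + (\<Sum>x=Suc r..<T. q ^ x * (1 - q) * h x) / (1 - q ^ T))" .
    have "(\<Sum>x=Suc r..<T. q ^ x * (1 - q) * h x) \<le> (\<Sum>x=Suc r..N. q ^ x * (1 - q) * h x)"
      using q h T by (intro sum_mono2) auto
    also have "\<dots> \<le> (1 - q ^ Suc r) * (g r - g (Suc r))" by (rule G)
    finally have "(\<Sum>x=Suc r..<T. q ^ x * (1 - q) * h x) / (1 - q ^ T) \<le> (1 - q ^ Suc r) * (g r - g (Suc r)) / (1 - q ^ T)"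
      using pos by (intro divide_right_mono) auto
    also have "\<dots> = - ((1 - q ^ Suc r) / (1 - q ^ T) * (g (Suc r) - g r))"
      by (simp add: minus_divide_left algebra_simps)
    finally show ?thesis unfolding eq by linarith
  qed
qed

text \<open>Markov's inequality: a chain of \<open>Suc m\<close> entries has weight 1, and the
  expected total weight is bounded by that of the one-entry chains born at the \<open>n\<close>
  positions.\<close>

lemma prob_code_LDS_ge:
  assumes q: "0 < q" "q < 1"
  shows "code_expect q {1..n} (\<lambda>a. of_bool (Suc m \<le> code_LDS n a)) \<le> real n / (1 - q) * pot_tail q n m 0"
proof -
  \<comment> \<open>A chain of length \<open>l\<close> is weighted by the expected number of its
    completions to length \<open>Suc m\<close>; longer chains get weight 0, so a completed chain
    passes nothing on.\<close>
  define G where "G l r = (if l \<le> Suc m then pot q n (Suc m - l) r else 0)" for l r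
  have Gn: "0 \<le> G l r" for l r using pot_nonneg[OF q] by (simp add: G_def)
  have sub: "(\<Sum>x<T. geo q T x * (G l (if x \<le> r then Suc r else r) + (if r < x then G (Suc l) x else 0))) \<le> G l r"
    if "T \<in> {1..n}" for T l r
  proof (rule pot_supersolution[OF q that _ Gn])
    fix r
    show "(\<Sum>x=Suc r..n. q ^ x * (1 - q) * G (Suc l) x) \<le> (1 - q ^ Suc r) * (G l r - G l (Suc r))"
    proof (cases "l \<le> m")
      case True
      then have "Suc m - l = Suc (m - l)" by simp
      then show ?thesis using pot_step[OF q, of r n "m - l"] True
        by (simp add: G_def pot_tail_def del: pot.simps)
    next
      case False
      then show ?thesis by (auto simp: G_def le_Suc_eq)
    qed
  qed
  have "code_expect q {1..n} (\<lambda>a. of_bool (Suc m \<le> code_LDS n a)) \<le> code_expect q {1..n} (\<lambda>a. \<Sum>(l, r)\<leftarrow>chain_profile a n. G l r)"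
  proof (rule code_expect_mono)
    fix a
    have nn: "0 \<le> (\<Sum>(l, r)\<leftarrow>xs. G l r)" for xs
      using Gn by (intro sum_list_nonneg) auto
    have mem: "G l r \<le> (\<Sum>(l, r)\<leftarrow>xs. G l r)" if "(l, r) \<in> set xs" for l r xs
      using that Gn by (intro member_le_sum_list) force+
    show "of_bool (Suc m \<le> code_LDS n a) \<le> (\<Sum>(l, r)\<leftarrow>chain_profile a n. G l r)"
    proof (cases "Suc m \<le> code_LDS n a")
      case True
      then obtain I where I: "I \<subseteq> {1..n}" "dec_chain a I" "card I = Suc m"
        by (rule code_LDS_witness_le)
      then have "I \<noteq> {}" by auto
      from mem[OF chain_in_chains[OF I(1) this I(2)]] I(3) True show ?thesis by (simp add: G_def)
    qed (use nn in simp)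
  qed (use q in simp)
  also have "\<dots> \<le> (\<Sum>i=1..n. \<Sum>k<i. geo q i k * G 1 k)"
    using q sub by (intro code_expect_chains_le) auto
  also have "\<dots> \<le> (\<Sum>i=1..n. 1 / (1 - q) * pot_tail q n m 0)"
  proof (rule sum_mono)
    fix i assume i: "i \<in> {1..n}"
    \<comment> \<open>The truncation factor is largest at \<open>i = 1\<close>, which gives the
      factor \<open>1 / (1 - q)\<close>.\<close>
    have "1 - q \<le> 1 - q ^ i" using q i power_decreasing[of 1 i q] by simp
    then have pos: "1 / (1 - q ^ i) \<le> 1 / (1 - q)" using q by (intro divide_left_mono mult_pos_pos) auto
    have "(\<Sum>k<i. geo q i k * G 1 k) = 1 / (1 - q ^ i) * (\<Sum>k<i. q ^ k * (1 - q) * pot q n m k)"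
      using q by (simp add: G_def geo_eq sum_divide_distrib)
    also have "\<dots> \<le> 1 / (1 - q) * pot_tail q n m 0"
      unfolding pot_tail_def using q i pot_nonneg[OF q]
      by (intro mult_mono pos sum_mono2 sum_nonneg) auto
    finally show "(\<Sum>k<i. geo q i k * G 1 k) \<le> 1 / (1 - q) * pot_tail q n m 0" .
  qed
  finally show ?thesis by simp
qed

text \<open>Cut at \<open>m\<close>; on the exceptional event the length is at most
  \<open>n\<close>.\<close>

lemma expected_LDS_upper:
  assumes q: "0 < q" "q < 1"
  shows "expected_LDS n q \<le> real m + real n * (real n / (1 - q) * pot_tail q n m 0)"
proof -
  have "expected_LDS n q \<le> code_expect q {1..n} (\<lambda>a. real m + real n * of_bool (Suc m \<le> code_LDS n a))"
    unfolding expected_LDS_eq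
    by (rule code_expect_mono) (use q code_LDS_le in \<open>auto simp: not_less_eq_eq intro: order_trans[of _ "real n"]\<close>)
  also have "\<dots> = real m + real n * code_expect q {1..n} (\<lambda>a. of_bool (Suc m \<le> code_LDS n a))"
    using q by (simp only: code_expect_add code_expect_cmult) (simp add: code_expect_const)
  also have "\<dots> \<le> real m + real n * (real n / (1 - q) * pot_tail q n m 0)"
    using prob_code_LDS_ge[OF q] by (intro add_left_mono mult_left_mono) auto
  finally show ?thesis .
qed

section \<open>Two estimates of the potential\<close>

lemma sum_geometric_tail_le:
  fixes x :: real
  assumes "0 < x" "x < 1"
  shows "(\<Sum>k=R..N. x ^ k) \<le> x ^ R / (1 - x)"
proof (cases "R \<le> N")
  case True
  then have "(1 - x) * (\<Sum>k=R..N. x ^ k) = x ^ R - x ^ Suc N"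
    using sum_gp_multiplied[of R N x] by simp
  also have "\<dots> \<le> x ^ R" using assms by simp
  finally show ?thesis using assms by (simp add: field_simps)
qed (use assms in simp)

lemma pot_tail_Suc:
  "pot_tail q N (Suc m) R = (\<Sum>x=R..N. q ^ x * (1 - q) * (\<Sum>s=x..N. pot_tail q N m (Suc s) / (1 - q ^ Suc s)))"
  unfolding pot_tail_def[of q N "Suc m"] pot_Suc ..

lemma pot_tail_0_le:
  assumes "0 < q" "q < 1"
  shows "pot_tail q N 0 R \<le> q ^ R"
proof -
  have "pot_tail q N 0 R = (1 - q) * (\<Sum>x=R..N. q ^ x)"
    by (simp add: pot_tail_def sum_distrib_left mult.commute)
  also have "\<dots> \<le> (1 - q) * (q ^ R / (1 - q))"
    using assms by (intro mult_left_mono sum_geometric_tail_le) auto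
  finally show ?thesis using assms by simp
qed

text \<open>Each denominator \<open>1 - q ^ Suc s\<close> is replaced by \<open>1 - q\<close>, which
  leaves nested geometric series. Every level costs two factors \<open>1 / (1 - q)\<close>, one from
  the denominator and one from the sum over \<open>s\<close>. The shift from \<open>s\<close> to
  \<open>Suc s\<close> gains \<open>q ^ Suc m\<close>, and these gains add up to the exponent
  \<open>m (m + 1) / 2\<close>.\<close>

lemma pot_tail_le_gaussian:
  assumes q: "0 < q" "q < 1"
  shows "pot_tail q N m R \<le> q ^ (Suc m * R) * q ^ (\<Sum>{..m}) / (1 - q) ^ (2 * m)"
proof (induction m arbitrary: R)
  case 0
  then show ?case using pot_tail_0_le[OF q] by simp
next
  case (Suc m)
  let ?y = "q ^ Suc m" and ?c = "q ^ (\<Sum>{..m}) / (1 - q) ^ (2 * m)"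
  have c: "0 \<le> ?c" using q by simp
  have y: "0 < ?y" "?y < 1" using one_minus_power_pos[OF q, of "Suc m"] q by auto
  have y1: "?y \<le> q" using q power_decreasing[of 1 "Suc m" q] by simp
  have inner: "(\<Sum>s=x..N. pot_tail q N m (Suc s) / (1 - q ^ Suc s)) \<le> ?c * ?y ^ Suc R / (1 - q) ^ 2"
    if "R \<le> x" for x
  proof -
    have "pot_tail q N m (Suc s) / (1 - q ^ Suc s) \<le> ?c * ?y ^ Suc s / (1 - q)" for s
    proof (rule frac_le)
      show "pot_tail q N m (Suc s) \<le> ?c * ?y ^ Suc s"
        using Suc.IH[of "Suc s"] by (simp only: power_mult) (simp add: mult_ac)
      show "0 \<le> ?c * ?y ^ Suc s" using c q by (intro mult_nonneg_nonneg zero_le_power) auto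
      show "1 - q \<le> 1 - q ^ Suc s" using q power_decreasing[of 1 "Suc s" q] by simp
    qed (use q in simp)
    then have "(\<Sum>s=x..N. pot_tail q N m (Suc s) / (1 - q ^ Suc s)) \<le> (\<Sum>s=x..N. ?c * ?y / (1 - q) * ?y ^ s)"
      by (intro sum_mono) (simp add: mult_ac)
    also have "\<dots> = ?c * ?y / (1 - q) * (\<Sum>s=x..N. ?y ^ s)" by (rule sum_distrib_left[symmetric])
    also have "\<dots> \<le> ?c * ?y / (1 - q) * (?y ^ x / (1 - ?y))"
      using c y q by (intro mult_left_mono sum_geometric_tail_le) auto
    \<comment> \<open>The decay in \<open>x\<close> is given up for a bound in \<open>R\<close>
      alone, and \<open>1 - ?y\<close> is bounded below by \<open>1 - q\<close>.\<close>
    also have "\<dots> \<le> ?c * ?y / (1 - q) * (?y ^ R / (1 - q))"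
      using c y q y1 that by (intro mult_left_mono frac_le power_decreasing) auto
    also have "\<dots> = ?c * ?y ^ Suc R / (1 - q) ^ 2" by (simp add: power2_eq_square mult_ac)
    finally show ?thesis .
  qed
  have "pot_tail q N (Suc m) R \<le> (\<Sum>x=R..N. q ^ x * (1 - q) * (?c * ?y ^ Suc R / (1 - q) ^ 2))"
    unfolding pot_tail_Suc using q by (intro sum_mono mult_left_mono inner) auto
  also have "\<dots> = (\<Sum>x=R..N. q ^ x) * ((1 - q) * (?c * ?y ^ Suc R / (1 - q) ^ 2))"
    by (simp only: sum_distrib_right mult.assoc)
  also have "\<dots> \<le> q ^ R / (1 - q) * ((1 - q) * (?c * ?y ^ Suc R / (1 - q) ^ 2))"
    using q c y by (intro mult_right_mono sum_geometric_tail_le) auto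
  also have "\<dots> = q ^ R * (?c * ?y ^ Suc R / (1 - q) ^ 2)" using q by simp
  also have "\<dots> = q ^ (Suc (Suc m) * R) * q ^ (\<Sum>{..Suc m}) / (1 - q) ^ (2 * Suc m)"
  proof -
    have "q ^ R * ?y ^ Suc R = q ^ (Suc (Suc m) * R) * q ^ Suc m"
      by (simp add: power_add power_mult[symmetric] algebra_simps)
    moreover have "q ^ (\<Sum>{..Suc m}) = q ^ (\<Sum>{..m}) * q ^ Suc m" by (simp add: power_add)
    moreover have "(1 - q) ^ (2 * Suc m) = (1 - q) ^ (2 * m) * (1 - q) ^ 2" by (simp add: power_add[symmetric])
    ultimately show ?thesis by (simp add: mult_ac del: power_Suc mult_Suc mult_Suc_right) 
  qed
  finally show ?case .
qed

lemma power_Suc_add_ge: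
  fixes y h :: real
  assumes "0 \<le> y" "0 \<le> h"
  shows "y ^ Suc m + real (Suc m) * h * y ^ m \<le> (y + h) ^ Suc m"
proof (induction m)
  case (Suc m)
  have "y ^ Suc (Suc m) + real (Suc (Suc m)) * h * y ^ Suc m \<le>
      (y + h) * (y ^ Suc m + real (Suc m) * h * y ^ m)"
    using assms by (simp add: algebra_simps)
  also have "\<dots> \<le> (y + h) * (y + h) ^ Suc m" using Suc assms by (intro mult_left_mono) auto
  finally show ?case by simp
qed simp

text \<open>Discrete form of integrating \<open>-Y' * Y ^ m\<close> to
  \<open>Y ^ Suc m / (m + 1)\<close>, by downward induction on \<open>R\<close>. Each step keeps the
  first two terms of the binomial expansion of \<open>(Y (Suc R) + h R) ^ Suc m\<close>.\<close>

lemma sum_mult_tail_power_le: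
  fixes h :: "nat \<Rightarrow> real"
  assumes h: "\<And>k. 0 \<le> h k" and "R \<le> Suc N"
  defines "Y \<equiv> \<lambda>R. \<Sum>k=R..N. h k"
  shows "(\<Sum>k=R..N. h k * Y (Suc k) ^ m) \<le> Y R ^ Suc m / real (Suc m)"
  using assms(2)
proof (induction R rule: inc_induct)
  case base
  then show ?case by (simp add: Y_def)
next
  case (step R)
  have Y: "0 \<le> Y R" for R unfolding Y_def by (intro sum_nonneg h)
  have "R \<le> N" using step by simp
  then have YR: "Y R = Y (Suc R) + h R" unfolding Y_def by (simp add: sum.atLeast_Suc_atMost)
  have "(\<Sum>k=R..N. h k * Y (Suc k) ^ m) = h R * Y (Suc R) ^ m + (\<Sum>k=Suc R..N. h k * Y (Suc k) ^ m)"
    using \<open>R \<le> N\<close> by (simp add: sum.atLeast_Suc_atMost)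
  also have "\<dots> \<le> h R * Y (Suc R) ^ m + Y (Suc R) ^ Suc m / real (Suc m)" using step by simp
  also have "\<dots> = (Y (Suc R) ^ Suc m + real (Suc m) * h R * Y (Suc R) ^ m) / real (Suc m)"
    by (simp add: add_divide_distrib del: of_nat_Suc)
  also have "\<dots> \<le> (Y (Suc R) + h R) ^ Suc m / real (Suc m)"
    by (intro divide_right_mono power_Suc_add_ge Y h) auto
  finally show ?case unfolding YR .
qed

text \<open>The weights come from splitting \<open>1 / (1 - q^(s+1))\<close> evenly between two consecutive summation
  indices \<open>x \<le> s\<close>: each index then carries a weight of order \<open>1 / \<surd>k\<close>, whose sum up to
  \<open>1 / (1 - q)\<close> has no logarithm, and the two orderings of the indices give \<open>1 / (m!)\<^sup>2\<close>.\<close>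

definition wt :: "real \<Rightarrow> nat \<Rightarrow> real" where
  "wt q k = sqrt (1 - q) * sqrt q ^ k / sqrt (1 - q ^ Suc k)"

lemma wt_nonneg: "0 < q \<Longrightarrow> q < 1 \<Longrightarrow> 0 \<le> wt q k"
  using one_minus_power_pos[of q "Suc k"] by (simp add: wt_def)

text \<open>As \<open>x \<le> s\<close>, the denominator \<open>1 - q ^ Suc s\<close> is at least
  the geometric mean of the denominators at \<open>x\<close> and \<open>s\<close>. Of the two halves
  \<open>sqrt q ^ x\<close> of \<open>q ^ x\<close>, one enters \<open>wt q x\<close> and the other
  is bounded by \<open>sqrt q ^ R\<close>.\<close>

lemma wt_mult_ge:
  assumes q: "0 < q" "q < 1" and "R \<le> x" "x \<le> s"
  shows "q ^ x * (1 - q) * (sqrt q ^ Suc s / (1 - q ^ Suc s)) \<le> sqrt q ^ R * (wt q x * wt q s)"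
proof -
  have px: "0 < 1 - q ^ Suc x" "0 < 1 - q ^ Suc s"
    using one_minus_power_pos[OF q, of "Suc x"] one_minus_power_pos[OF q, of "Suc s"] by auto
  have "q ^ Suc s \<le> q ^ Suc x" using assms by (intro power_decreasing) auto
  then have "sqrt (1 - q ^ Suc x) \<le> sqrt (1 - q ^ Suc s)" by simp
  then have "sqrt (1 - q ^ Suc x) * sqrt (1 - q ^ Suc s) \<le> sqrt (1 - q ^ Suc s) * sqrt (1 - q ^ Suc s)"
    using px by (intro mult_right_mono) auto
  then have den: "sqrt (1 - q ^ Suc x) * sqrt (1 - q ^ Suc s) \<le> 1 - q ^ Suc s"
    using px by simp
  have qx: "q ^ x = sqrt q ^ x * sqrt q ^ x" using q by (simp add: power_mult_distrib[symmetric])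
  have num: "q ^ x * (1 - q) * sqrt q ^ Suc s \<le> sqrt q ^ R * ((1 - q) * sqrt q ^ x * sqrt q ^ s)"
  proof -
    have "sqrt q ^ x \<le> sqrt q ^ R" using assms by (intro power_decreasing) auto
    moreover have "sqrt q ^ Suc s \<le> sqrt q ^ s" using q by (intro power_decreasing) auto
    ultimately have "sqrt q ^ x * ((1 - q) * sqrt q ^ x * sqrt q ^ Suc s) \<le> sqrt q ^ R * ((1 - q) * sqrt q ^ x * sqrt q ^ s)"
      using q by (intro mult_mono) auto
    then show ?thesis by (simp only: qx mult_ac)
  qed
  have "q ^ x * (1 - q) * (sqrt q ^ Suc s / (1 - q ^ Suc s)) = (q ^ x * (1 - q) * sqrt q ^ Suc s) / (1 - q ^ Suc s)"
    by simp
  also have "\<dots> \<le> sqrt q ^ R * ((1 - q) * sqrt q ^ x * sqrt q ^ s) / (sqrt (1 - q ^ Suc x) * sqrt (1 - q ^ Suc s))"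
    using q px den num by (intro frac_le mult_pos_pos) auto
  also have "(1 - q) * sqrt q ^ x * sqrt q ^ s = (sqrt (1 - q) * sqrt q ^ x) * (sqrt (1 - q) * sqrt q ^ s)"
    using q by (simp add: mult_ac)
  also have "sqrt q ^ R * ((sqrt (1 - q) * sqrt q ^ x) * (sqrt (1 - q) * sqrt q ^ s)) / (sqrt (1 - q ^ Suc x) * sqrt (1 - q ^ Suc s))
      = sqrt q ^ R * (wt q x * wt q s)"
    unfolding wt_def by (simp only: divide_inverse inverse_mult_distrib mult_ac)
  finally show ?thesis .
qed

text \<open>With \<open>p = sqrt q\<close>, bounding \<open>q ^ Suc k\<close> by
  \<open>p ^ Suc k\<close> makes \<open>wt q k\<close> at most a constant multiple of the increment
  of \<open>sqrt (1 - p ^ k)\<close>, and the sum telescopes. The final constant uses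
  \<open>1 - q = (1 - p) (1 + p) \<le> 2 (1 - p)\<close>.\<close>

lemma sum_wt_le:
  assumes q: "0 < q" "q < 1"
  shows "(\<Sum>k=0..N. wt q k) \<le> 4 / sqrt (1 - q)"
proof -
  define p where "p = sqrt q"
  have p: "0 < p" "p < 1" "p\<^sup>2 = q" using q by (auto simp: p_def)
  have tele: "wt q k \<le> sqrt (1 - q) * (2 / (1 - p)) * (sqrt (1 - p ^ Suc k) - sqrt (1 - p ^ k))" for k
  proof -
    define A B where "A = sqrt (1 - p ^ Suc k)" and "B = sqrt (1 - p ^ k)"
    have "0 < 1 - p ^ Suc k" using one_minus_power_pos[of p "Suc k"] p by simp
    then have A: "0 < A" "A\<^sup>2 = 1 - p ^ Suc k" by (auto simp: A_def)
    have "p ^ k \<le> 1" using p by (simp add: power_le_one)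
    then have B: "0 \<le> B" "B\<^sup>2 = 1 - p ^ k" by (auto simp: B_def)
    have "p ^ Suc k \<le> p ^ k" using p by (intro power_decreasing) auto
    then have AB: "B \<le> A" by (simp add: A_def B_def)
    have "p ^ k * (1 - p) = A\<^sup>2 - B\<^sup>2" using A B by (simp add: algebra_simps)
    also have "\<dots> = (A + B) * (A - B)" by (simp add: power2_eq_square algebra_simps)
    also have "\<dots> \<le> (2 * A) * (A - B)" using AB by (intro mult_right_mono) auto
    finally have 1: "p ^ k / A \<le> 2 / (1 - p) * (A - B)"
      using A p by (simp add: field_simps)
    have "q ^ Suc k \<le> p ^ Suc k"
    proof -
      have "q \<le> p" using p mult_left_le[of p p] by (simp add: power2_eq_square)
      then show ?thesis using q by (intro power_mono) auto
    qed
    then have "A \<le> sqrt (1 - q ^ Suc k)" by (simp add: A_def)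
    then have "sqrt (1 - q) * p ^ k / sqrt (1 - q ^ Suc k) \<le> sqrt (1 - q) * p ^ k / A"
      using A p q one_minus_power_pos[OF q, of "Suc k"] by (intro divide_left_mono mult_pos_pos) simp_all
    also have "\<dots> \<le> sqrt (1 - q) * (2 / (1 - p) * (A - B))"
      using 1 q mult_left_mono[OF 1, of "sqrt (1 - q)"] by simp
    finally show ?thesis unfolding wt_def p_def[symmetric] A_def B_def by (simp only: mult.assoc)
  qed
  have "(\<Sum>k=0..N. wt q k) \<le> (\<Sum>k=0..N. sqrt (1 - q) * (2 / (1 - p)) * (sqrt (1 - p ^ Suc k) - sqrt (1 - p ^ k)))"
    by (intro sum_mono tele)
  also have "\<dots> = sqrt (1 - q) * (2 / (1 - p)) * (\<Sum>k=0..N. sqrt (1 - p ^ Suc k) - sqrt (1 - p ^ k))"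
    by (rule sum_distrib_left[symmetric])
  also have "(\<Sum>k=0..N. sqrt (1 - p ^ Suc k) - sqrt (1 - p ^ k)) = sqrt (1 - p ^ Suc N) - sqrt (1 - p ^ 0)"
    by (rule sum_Suc_diff) simp
  also have "sqrt (1 - q) * (2 / (1 - p)) * \<dots> \<le> sqrt (1 - q) * (2 / (1 - p)) * 1"
    using p q by (intro mult_left_mono) auto
  also have "\<dots> \<le> sqrt (1 - q) * (4 / (1 - q))"
  proof -
    have "1 - q = (1 - p) * (1 + p)" using p by (simp add: power2_eq_square algebra_simps)
    also have "\<dots> \<le> (1 - p) * 2" using p by (intro mult_left_mono) auto
    finally have "2 / (1 - p) \<le> 4 / (1 - q)" using p q by (simp add: field_simps)
    then have "sqrt (1 - q) * (2 / (1 - p)) \<le> sqrt (1 - q) * (4 / (1 - q))"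
      using q by (intro mult_left_mono) auto
    then show ?thesis by (simp only: mult_1_right)
  qed
  also have "\<dots> = 4 / sqrt (1 - q)"
  proof -
    have "r * (4 / r\<^sup>2) = 4 / r" if "0 < r" for r :: real
      using that by (simp add: power2_eq_square)
    from this[of "sqrt (1 - q)"] show ?thesis using q by simp
  qed
  finally show ?thesis .
qed

text \<open>Each level of the recursion contains one sum over \<open>x\<close> and one over
  \<open>s\<close>. Once the two are decoupled, \<open>sum_mult_tail_power_le\<close> gives a factor
  \<open>1 / (m + 1)\<close> for each of them, whence the square of the factorial.\<close>

lemma pot_tail_le_factorial:
  assumes q: "0 < q" "q < 1"
  shows "pot_tail q N m R \<le> sqrt q ^ R * ((\<Sum>k=R..N. wt q k) ^ m / fact m)\<^sup>2"
proof (induction m arbitrary: R)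
  case 0
  have "pot_tail q N 0 R \<le> q ^ R" by (rule pot_tail_0_le[OF q])
  also have "q \<le> sqrt q" using q real_le_rsqrt[of q q] mult_left_le[of q q] by (simp add: power2_eq_square)
  then have "q ^ R \<le> sqrt q ^ R" using q by (intro power_mono) auto
  finally show ?case by simp
next
  case (Suc m)
  define Y where "Y R = (\<Sum>k=R..N. wt q k)" for R
  have Y0: "0 \<le> Y R" for R unfolding Y_def using wt_nonneg[OF q] by (simp add: sum_nonneg)
  have Ymono: "Y s \<le> Y r" if "r \<le> s" for r s
    unfolding Y_def using wt_nonneg[OF q] that by (intro sum_mono2) auto
  have YS: "(\<Sum>k=R..N. wt q k * Y (Suc k) ^ m) \<le> Y R ^ Suc m / real (Suc m)" if "R \<le> N" for R
    unfolding Y_def using that wt_nonneg[OF q] by (intro sum_mult_tail_power_le) auto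
  show ?case
  proof (cases "R \<le> N")
    case False
    then show ?thesis using q by (simp add: pot_tail_def)
  next
    case True
    let ?f = "fact m :: real"
    have inner: "q ^ x * (1 - q) * (\<Sum>s=x..N. pot_tail q N m (Suc s) / (1 - q ^ Suc s)) \<le>
        sqrt q ^ R / ?f\<^sup>2 * (Y R ^ Suc m / real (Suc m)) * (wt q x * Y (Suc x) ^ m)"
      if x: "x \<in> {R..N}" for x
    proof -
      have "q ^ x * (1 - q) * (\<Sum>s=x..N. pot_tail q N m (Suc s) / (1 - q ^ Suc s)) =
          (\<Sum>s=x..N. q ^ x * (1 - q) * (pot_tail q N m (Suc s) / (1 - q ^ Suc s)))"
        by (rule sum_distrib_left)
      also have "\<dots> \<le> (\<Sum>s=x..N. sqrt q ^ R / ?f\<^sup>2 * (wt q x * Y (Suc x) ^ m) * (wt q s * Y (Suc s) ^ m))"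
      proof (rule sum_mono)
        fix s assume s: "s \<in> {x..N}"
        have ps: "0 < 1 - q ^ Suc s" using one_minus_power_pos[OF q, of "Suc s"] by simp
        have "pot_tail q N m (Suc s) \<le> sqrt q ^ Suc s * (Y (Suc s) ^ m / ?f)\<^sup>2"
          unfolding Y_def by (rule Suc.IH)
        also have "(Y (Suc s) ^ m / ?f)\<^sup>2 = Y (Suc s) ^ m * Y (Suc s) ^ m / ?f\<^sup>2"
          by (simp add: power2_eq_square)
        \<comment> \<open>One of the two powers is moved from \<open>s\<close> to the smaller index
          \<open>x\<close>, where \<open>Y\<close> is larger, so that each index carries its own
          weight and power.\<close>
        also have "sqrt q ^ Suc s * (Y (Suc s) ^ m * Y (Suc s) ^ m / ?f\<^sup>2) \<le> sqrt q ^ Suc s * (Y (Suc x) ^ m * Y (Suc s) ^ m / ?f\<^sup>2)"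
          using q s Y0 by (intro mult_left_mono divide_right_mono mult_right_mono power_mono Ymono) auto
        finally have "pot_tail q N m (Suc s) / (1 - q ^ Suc s) \<le> sqrt q ^ Suc s * (Y (Suc x) ^ m * Y (Suc s) ^ m / ?f\<^sup>2) / (1 - q ^ Suc s)"
          using ps by (intro divide_right_mono) auto
        then have "q ^ x * (1 - q) * (pot_tail q N m (Suc s) / (1 - q ^ Suc s)) \<le>
            q ^ x * (1 - q) * (sqrt q ^ Suc s * (Y (Suc x) ^ m * Y (Suc s) ^ m / ?f\<^sup>2) / (1 - q ^ Suc s))"
          using q by (intro mult_left_mono) auto
        also have "\<dots> = q ^ x * (1 - q) * (sqrt q ^ Suc s / (1 - q ^ Suc s)) * (Y (Suc x) ^ m * Y (Suc s) ^ m / ?f\<^sup>2)"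
          by (simp only: divide_inverse mult_ac)
        also have "\<dots> \<le> sqrt q ^ R * (wt q x * wt q s) * (Y (Suc x) ^ m * Y (Suc s) ^ m / ?f\<^sup>2)"
          using q x s Y0 by (intro mult_right_mono wt_mult_ge) auto
        finally show "q ^ x * (1 - q) * (pot_tail q N m (Suc s) / (1 - q ^ Suc s)) \<le>
            sqrt q ^ R / ?f\<^sup>2 * (wt q x * Y (Suc x) ^ m) * (wt q s * Y (Suc s) ^ m)"
          by (simp add: mult_ac)
      qed
      also have "\<dots> = sqrt q ^ R / ?f\<^sup>2 * (wt q x * Y (Suc x) ^ m) * (\<Sum>s=x..N. wt q s * Y (Suc s) ^ m)"
        by (rule sum_distrib_left[symmetric])
      also have "\<dots> \<le> sqrt q ^ R / ?f\<^sup>2 * (wt q x * Y (Suc x) ^ m) * (Y R ^ Suc m / real (Suc m))"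
      proof (intro mult_left_mono)
        have "(\<Sum>s=x..N. wt q s * Y (Suc s) ^ m) \<le> Y x ^ Suc m / real (Suc m)" using x by (intro YS) auto
        also have "\<dots> \<le> Y R ^ Suc m / real (Suc m)"
          using x Y0 by (intro divide_right_mono power_mono Ymono) auto
        finally show "(\<Sum>s=x..N. wt q s * Y (Suc s) ^ m) \<le> Y R ^ Suc m / real (Suc m)" .
      qed (use q Y0 wt_nonneg[OF q] in auto)
      finally show ?thesis by (simp only: mult_ac)
    qed
    have "pot_tail q N (Suc m) R \<le> (\<Sum>x=R..N. sqrt q ^ R / ?f\<^sup>2 * (Y R ^ Suc m / real (Suc m)) * (wt q x * Y (Suc x) ^ m))"
      unfolding pot_tail_Suc by (intro sum_mono inner)
    also have "\<dots> = sqrt q ^ R / ?f\<^sup>2 * (Y R ^ Suc m / real (Suc m)) * (\<Sum>x=R..N. wt q x * Y (Suc x) ^ m)"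
      by (rule sum_distrib_left[symmetric])
    also have "\<dots> \<le> sqrt q ^ R / ?f\<^sup>2 * (Y R ^ Suc m / real (Suc m)) * (Y R ^ Suc m / real (Suc m))"
      using q Y0[of R] by (intro mult_left_mono YS True) auto
    also have "\<dots> = sqrt q ^ R * (Y R ^ Suc m / fact (Suc m))\<^sup>2"
      by (simp add: power2_eq_square mult_ac)
    finally show ?thesis unfolding Y_def .
  qed
qed

lemma pot_tail_le_factorial_sq:
  assumes q: "0 < q" "q < 1"
  shows "pot_tail q N m 0 \<le> (16 / (1 - q)) ^ m / (fact m)\<^sup>2"
proof -
  have "pot_tail q N m 0 \<le> ((\<Sum>k=0..N. wt q k) ^ m / fact m)\<^sup>2"
    using pot_tail_le_factorial[OF q, of N m 0] by simp
  also have "\<dots> \<le> ((4 / sqrt (1 - q)) ^ m / fact m)\<^sup>2"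
    using wt_nonneg[OF q] by (intro power_mono divide_right_mono sum_wt_le[OF q]) (auto intro!: sum_nonneg divide_nonneg_nonneg zero_le_power)
  also have "\<dots> = ((4 / sqrt (1 - q))\<^sup>2) ^ m / (fact m)\<^sup>2"
    unfolding power_divide[of "(4 / sqrt (1 - q)) ^ m"] by (simp only: power_mult[symmetric] mult.commute)
  also have "(4 / sqrt (1 - q))\<^sup>2 = 16 / (1 - q)" using q by (simp add: power_divide)
  finally show ?thesis .
qed

section \<open>The lower bound: planting decreasing subsequences\<close>

text \<open>Run \<open>s\<close> consists of \<open>m\<close> consecutive blocks of length
  \<open>\<tau>\<close>. The offset \<open>3 * \<tau> * m\<close> lets every later position take all
  code values below \<open>3 * \<tau> * m\<close>.\<close>

definition block :: "nat \<Rightarrow> nat \<Rightarrow> nat \<Rightarrow> nat \<Rightarrow> nat set" where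
  "block m \<tau> s j = {3 * \<tau> * m + (s * m + j) * \<tau> <.. 3 * \<tau> * m + (s * m + j + 1) * \<tau>}"

text \<open>The windows have length \<open>\<tau>\<close> and lie \<open>3 * \<tau>\<close> apart: a
  code value in window \<open>j\<close> plus the at most \<open>2 * \<tau>\<close> steps to the end
  of block \<open>j + 1\<close> stays below window \<open>j + 1\<close>.\<close>

definition hit :: "nat \<Rightarrow> nat \<Rightarrow> nat \<Rightarrow> nat \<Rightarrow> (nat \<Rightarrow> nat) \<Rightarrow> bool" where
  "hit m \<tau> s j a \<longleftrightarrow> (\<exists>t\<in>block m \<tau> s j. a t \<in> {3 * \<tau> * j ..< 3 * \<tau> * j + \<tau>})"

lemma finite_block [simp]: "finite (block m \<tau> s j)" by (simp add: block_def)

lemma card_block [simp]: "card (block m \<tau> s j) = \<tau>" by (simp add: block_def)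

lemma block_less:
  assumes "t \<in> block m \<tau> s j" "t' \<in> block m \<tau> s' j'" "s * m + j < s' * m + j'"
  shows "t < t'"
proof -
  have "(s * m + j + 1) * \<tau> \<le> (s' * m + j') * \<tau>" using assms(3) by (intro mult_right_mono) auto
  then show ?thesis using assms by (auto simp: block_def)
qed

lemma block_unique:
  assumes "t \<in> block m \<tau> s j" "t \<in> block m \<tau> s' j'" "j < m" "j' < m"
  shows "s = s'" "j = j'"
proof -
  have eq: "s * m + j = s' * m + j'"
    using block_less[OF assms(1,2)] block_less[OF assms(2,1)] by (metis less_irrefl linorder_neqE_nat)
  then have "(s * m + j) div m = (s' * m + j') div m" by simp
  then show "s = s'" using assms by simp
  with eq show "j = j'" by simp
qed

lemma block_subset:
  assumes "(3 + g) * \<tau> * m \<le> n" "s < g" "j < m"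
  shows "block m \<tau> s j \<subseteq> {1..n}"
proof -
  have "s * m + j + 1 \<le> (s + 1) * m" using assms by simp
  also have "\<dots> \<le> g * m" using assms by (intro mult_right_mono) auto
  finally have "(s * m + j + 1) * \<tau> \<le> g * m * \<tau>" by (rule mult_right_mono) simp
  then have "3 * \<tau> * m + (s * m + j + 1) * \<tau> \<le> n" using assms(1) by (simp add: algebra_simps)
  then show ?thesis by (auto simp: block_def)
qed

lemma rk_le: "rk a i d \<le> a i + d"
  by (induction d) auto

text \<open>One hitting position is chosen in each successful block. A rank grows by at most one per
  step, so it cannot catch up with the window of a later block.\<close>

lemma card_hits_le_code_LDS:
  assumes n: "(3 + g) * \<tau> * m \<le> n" and s: "s < g"
  shows "card {j. j < m \<and> hit m \<tau> s j a} \<le> code_LDS n a"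
proof -
  let ?J = "{j. j < m \<and> hit m \<tau> s j a}"
  have "\<forall>j\<in>?J. \<exists>t. t \<in> block m \<tau> s j \<and> a t \<in> {3 * \<tau> * j ..< 3 * \<tau> * j + \<tau>}"
    by (auto simp: hit_def)
  then obtain t where t: "\<And>j. j \<in> ?J \<Longrightarrow> t j \<in> block m \<tau> s j"
    and a: "\<And>j. j \<in> ?J \<Longrightarrow> 3 * \<tau> * j \<le> a (t j) \<and> a (t j) < 3 * \<tau> * j + \<tau>"
    by (metis (no_types, lifting) atLeastLessThan_iff bchoice)
  have inj: "inj_on t ?J"
  proof (rule inj_onI)
    fix j j' assume "j \<in> ?J" "j' \<in> ?J" "t j = t j'"
    then show "j = j'" using block_unique(2)[of "t j" m \<tau> s j s j'] t by force
  qed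
  have "dec_chain a (t ` ?J)"
    unfolding dec_chain_def
  proof (intro ballI impI)
    fix x y assume x: "x \<in> t ` ?J" and y: "y \<in> t ` ?J" and xy: "x < y"
    from x obtain j where j: "j \<in> ?J" "x = t j" by blast
    from y obtain j' where j': "j' \<in> ?J" "y = t j'" by blast
    have "\<not> j' < j" using block_less[OF t[OF j'(1)] t[OF j(1)]] xy j j' by auto
    moreover have "j \<noteq> j'" using xy j j' by auto
    ultimately have "j < j'" by simp
    then obtain e where e: "j' = j + Suc e" using less_iff_Suc_add[of j j'] by auto
    have "rk a x (y - 1 - x) \<le> a x + (y - 1 - x)" by (rule rk_le)
    also have "a x < 3 * \<tau> * j + \<tau>" using a[OF j(1)] j by simp
    also have "y - 1 - x \<le> Suc (Suc e) * \<tau>"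
    proof -
      have "y \<le> 3 * \<tau> * m + (s * m + j' + 1) * \<tau>" "3 * \<tau> * m + (s * m + j) * \<tau> < x"
        using t[OF j(1)] t[OF j'(1)] j j' by (auto simp: block_def)
      moreover have "(s * m + j' + 1) * \<tau> = (s * m + j) * \<tau> + Suc (Suc e) * \<tau>"
        by (simp add: e algebra_simps)
      ultimately show ?thesis by linarith
    qed
    \<comment> \<open>With \<open>j' = j + e + 1\<close> this is
      \<open>e + 3 \<le> 3 (e + 1)\<close>, the inequality behind the spacing of the
      windows.\<close>
    also have "3 * \<tau> * j + \<tau> + Suc (Suc e) * \<tau> \<le> 3 * \<tau> * j'" by (simp add: e algebra_simps)
    also have "\<dots> \<le> a y" using a[OF j'(1)] j' by simp
    finally show "rk a x (y - 1 - x) < a y" by simp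
  qed
  moreover have "t ` ?J \<subseteq> {1..n}" using t block_subset[OF n s] by fastforce
  ultimately have "card (t ` ?J) \<le> code_LDS n a" by (intro card_le_code_LDS)
  then show ?thesis using inj by (simp add: card_image)
qed

text \<open>The window holds \<open>\<tau>\<close> values below \<open>3 * \<tau> * m\<close>, each
  of mass at least \<open>(1 - q) * q ^ (3 * \<tau> * m)\<close>, since truncation only enlarges the
  masses. The \<open>\<tau>\<close> positions of the block miss it independently.\<close>

lemma prob_hit_ge:
  assumes q: "0 < q" "q < 1" and j: "j < m"
  shows "1 - (1 - real \<tau> * ((1 - q) * q ^ (3 * \<tau> * m))) ^ \<tau> \<le> code_expect q (block m \<tau> s j) (\<lambda>a. of_bool (hit m \<tau> s j a))"
proof -
  let ?W = "{3 * \<tau> * j ..< 3 * \<tau> * j + \<tau>}" and ?B = "block m \<tau> s j"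
  have "3 * \<tau> * j + \<tau> \<le> 3 * \<tau> * Suc j" by simp
  also have "\<dots> \<le> 3 * \<tau> * m" using j by (intro mult_left_mono) auto
  finally have W: "3 * \<tau> * j + \<tau> \<le> 3 * \<tau> * m" .
  have zero: "0 \<notin> ?B" by (simp add: block_def)
  have single: "code_expect q {t} (\<lambda>a. of_bool (a t \<notin> ?W)) \<le> 1 - real \<tau> * ((1 - q) * q ^ (3 * \<tau> * m))"
      (is "_ \<le> 1 - real \<tau> * ?x")
    if t: "t \<in> ?B" for t
  proof -
    have t': "3 * \<tau> * m < t" using t by (auto simp: block_def intro: le_less_trans)
    have "code_expect q {t} (\<lambda>a. of_bool (a t \<notin> ?W)) = (\<Sum>k<t. geo q t k * of_bool (k \<notin> ?W))"
      by (simp add: code_expect_insert code_expect_empty)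
    also have "\<dots> = (\<Sum>k<t. geo q t k - (if k \<in> ?W then geo q t k else 0))"
      by (intro sum.cong) auto
    also have "\<dots> = 1 - (\<Sum>k<t. if k \<in> ?W then geo q t k else 0)"
      using sum_geo[of q t] q t' by (simp add: sum_subtractf)
    also have "(\<Sum>k<t. if k \<in> ?W then geo q t k else 0) = (\<Sum>k\<in>{..<t} \<inter> ?W. geo q t k)"
      by (simp add: sum.inter_restrict)
    also have "{..<t} \<inter> ?W = ?W" using W t' by auto
    also have "1 - (\<Sum>k\<in>?W. geo q t k) \<le> 1 - (\<Sum>k\<in>?W. ?x)"
    proof (intro diff_left_mono sum_mono)
      fix k assume k: "k \<in> ?W"
      have pos: "0 < 1 - q ^ t" using one_minus_power_pos[OF q, of t] t' by simp
      have "?x \<le> q ^ k * (1 - q)"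
        using q k W power_decreasing[of k "3 * \<tau> * m" q] by (simp add: mult.commute mult_left_mono)
      also have "\<dots> \<le> q ^ k * (1 - q) / (1 - q ^ t)"
        using q pos by (simp add: pos_le_divide_eq mult_left_le)
      finally show "?x \<le> geo q t k" using q by (simp add: geo_eq)
    qed
    finally show ?thesis by simp
  qed
  have "code_expect q ?B (\<lambda>a. of_bool (hit m \<tau> s j a)) = code_expect q ?B (\<lambda>a. 1 - (\<Prod>t\<in>?B. of_bool (a t \<notin> ?W)))"
  proof -
    have "(of_bool (hit m \<tau> s j a) :: real) = 1 - (\<Prod>t\<in>?B. of_bool (a t \<notin> ?W))" for a
    proof (cases "hit m \<tau> s j a")
      case True
      then obtain t where "t \<in> ?B" "a t \<in> ?W" by (auto simp: hit_def)
      then have "(\<Prod>t\<in>?B. of_bool (a t \<notin> ?W) :: real) = 0" by (intro prod_zero) auto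
      then show ?thesis using True by simp
    next
      case False
      then have "(\<Prod>t\<in>?B. of_bool (a t \<notin> ?W) :: real) = 1" by (intro prod.neutral) (auto simp: hit_def)
      then show ?thesis using False by simp
    qed
    then show ?thesis by simp
  qed
  also have "\<dots> = 1 - code_expect q ?B (\<lambda>a. \<Prod>t\<in>?B. of_bool (a t \<notin> ?W))"
    using q zero by (simp only: code_expect_diff) (simp add: code_expect_const)
  finally have eq: "code_expect q ?B (\<lambda>a. of_bool (hit m \<tau> s j a)) = 1 - code_expect q ?B (\<lambda>a. \<Prod>t\<in>?B. of_bool (a t \<notin> ?W))" .
  have "code_expect q ?B (\<lambda>a. \<Prod>t\<in>?B. of_bool (a t \<notin> ?W)) = (\<Prod>t\<in>?B. code_expect q {t} (\<lambda>a. of_bool (a t \<notin> ?W)))"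
    using code_expect_prod[of ?B "\<lambda>t. {t}" "\<lambda>t a. of_bool (a t \<notin> ?W)" q]
    by (simp add: disjoint_family_on_def depends_on_def)
  also have "\<dots> \<le> (\<Prod>t\<in>?B. 1 - real \<tau> * ((1 - q) * q ^ (3 * \<tau> * m)))"
  proof (rule prod_mono)
    fix t assume "t \<in> ?B"
    moreover have "0 \<le> code_expect q {t} (\<lambda>a. of_bool (a t \<notin> ?W))"
      unfolding code_expect_def using q geo_nonneg[of q] by (intro sum_nonneg) auto
    ultimately show "0 \<le> code_expect q {t} (\<lambda>a. of_bool (a t \<notin> ?W)) \<and>
        code_expect q {t} (\<lambda>a. of_bool (a t \<notin> ?W)) \<le> 1 - real \<tau> * ((1 - q) * q ^ (3 * \<tau> * m))"
      using single by blast
  qed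
  finally show ?thesis unfolding eq by simp
qed

lemma depends_on_hit: "depends_on (\<lambda>a. of_bool (hit m \<tau> s j a)) (block m \<tau> s j)"
  unfolding depends_on_def hit_def by auto

text \<open>The first bound is linearity of expectation over the blocks of one run. For the second,
  a run succeeds in all its blocks with probability at least \<open>\<sigma> ^ m\<close>, and the
  \<open>g\<close> runs are independent.\<close>

lemma expected_LDS_lower:
  assumes q: "0 < q" "q < 1" and n: "(3 + g) * \<tau> * m \<le> n"
  defines "\<sigma> \<equiv> 1 - (1 - real \<tau> * ((1 - q) * q ^ (3 * \<tau> * m))) ^ \<tau>"
  shows "0 < g \<Longrightarrow> real m * \<sigma> \<le> expected_LDS n q"
    and "0 \<le> \<sigma> \<Longrightarrow> real m * (1 - (1 - \<sigma> ^ m) ^ g) \<le> expected_LDS n q"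
proof -
  let ?h = "\<lambda>s j a. of_bool (hit m \<tau> s j a) :: real"
  assume g: "0 < g"
  have "real m * \<sigma> = (\<Sum>j<m. \<sigma>)" by simp
  also have "\<dots> \<le> (\<Sum>j<m. code_expect q (block m \<tau> 0 j) (?h 0 j))"
    unfolding \<sigma>_def by (intro sum_mono prob_hit_ge q) auto
  also have "\<dots> = (\<Sum>j<m. code_expect q {1..n} (?h 0 j))"
    using q g block_subset[OF n] depends_on_hit
    by (intro sum.cong refl code_expect_superset[symmetric]) auto
  also have "\<dots> = code_expect q {1..n} (\<lambda>a. \<Sum>j<m. ?h 0 j a)" by (rule code_expect_sum[symmetric])
  also have "\<dots> \<le> expected_LDS n q"
    unfolding expected_LDS_eq
  proof (rule code_expect_mono)
    fix a
    have "(\<Sum>j<m. ?h 0 j a) = real (card ({..<m} \<inter> {j. hit m \<tau> 0 j a}))" by (simp add: sum_of_bool_eq)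
    also have "{..<m} \<inter> {j. hit m \<tau> 0 j a} = {j. j < m \<and> hit m \<tau> 0 j a}" by auto
    finally show "(\<Sum>j<m. ?h 0 j a) \<le> real (code_LDS n a)"
      using card_hits_le_code_LDS[OF n g, of a] by simp
  qed (use q in simp)
  finally show "real m * \<sigma> \<le> expected_LDS n q" .
next
  let ?h = "\<lambda>s j a. of_bool (hit m \<tau> s j a) :: real"
  assume \<sigma>: "0 \<le> \<sigma>"
  define U where "U s = (\<Union>j<m. block m \<tau> s j)" for s
  \<comment> \<open>\<open>f s\<close> indicates that run \<open>s\<close> misses at least one of
    its windows.\<close>
  define f where "f s a = 1 - (\<Prod>j<m. ?h s j a)" for s a
  have U: "finite (U s)" for s by (simp add: U_def)
  have dU: "depends_on (\<lambda>a. \<Prod>j<m. ?h s j a) (U s)" for s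
    unfolding U_def by (intro depends_on_prod depends_on_hit)
  then have df: "depends_on (f s) (U s)" for s
    unfolding f_def depends_on_def by metis
  have disj: "disjoint_family_on U {..<g}"
    unfolding disjoint_family_on_def U_def using block_unique(1) by fastforce
  have sub: "U s \<subseteq> {1..n}" if "s < g" for s
    unfolding U_def using block_subset[OF n that] by auto
  have zero: "0 \<notin> U s" for s by (auto simp: U_def block_def)
  have all: "\<sigma> ^ m \<le> code_expect q (U s) (\<lambda>a. \<Prod>j<m. ?h s j a)" for s
  proof -
    have "\<sigma> ^ m = (\<Prod>j<m. \<sigma>)" by simp
    also have "\<dots> \<le> (\<Prod>j<m. code_expect q (block m \<tau> s j) (?h s j))"
      using \<sigma> unfolding \<sigma>_def by (intro prod_mono conjI prob_hit_ge q) auto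
    also have "\<dots> = code_expect q (U s) (\<lambda>a. \<Prod>j<m. ?h s j a)"
      unfolding U_def using block_unique(2) depends_on_hit
      by (intro code_expect_prod[symmetric]) (fastforce simp: disjoint_family_on_def)+
    finally show ?thesis .
  qed
  have f01: "0 \<le> f s a" for s a
    unfolding f_def by (simp add: prod_le_1)
  have "code_expect q {1..n} (\<lambda>a. \<Prod>s<g. f s a) = code_expect q (\<Union>s<g. U s) (\<lambda>a. \<Prod>s<g. f s a)"
    using q sub df by (intro code_expect_superset depends_on_prod) auto
  also have "\<dots> = (\<Prod>s<g. code_expect q (U s) (f s))"
    using U disj df by (intro code_expect_prod) auto
  also have "\<dots> \<le> (\<Prod>s<g. 1 - \<sigma> ^ m)"
  proof (rule prod_mono, intro conjI)
    fix s
    show "0 \<le> code_expect q (U s) (f s)"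
      unfolding code_expect_def using q geo_nonneg[of q] f01 by (intro sum_nonneg mult_nonneg_nonneg prod_nonneg) auto
    have "code_expect q (U s) (f s) = 1 - code_expect q (U s) (\<lambda>a. \<Prod>j<m. ?h s j a)"
      unfolding f_def using q U zero by (simp only: code_expect_diff) (simp add: code_expect_const)
    then show "code_expect q (U s) (f s) \<le> 1 - \<sigma> ^ m" using all[of s] by simp
  qed
  finally have *: "code_expect q {1..n} (\<lambda>a. \<Prod>s<g. f s a) \<le> (1 - \<sigma> ^ m) ^ g" by simp
  have "real m * (1 - (1 - \<sigma> ^ m) ^ g) \<le> real m * (1 - code_expect q {1..n} (\<lambda>a. \<Prod>s<g. f s a))"
    using * by (intro mult_left_mono) auto
  also have "\<dots> = code_expect q {1..n} (\<lambda>a. real m * (1 - (\<Prod>s<g. f s a)))"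
    using q by (simp only: code_expect_cmult code_expect_diff) (simp add: code_expect_const)
  also have "\<dots> \<le> expected_LDS n q"
    unfolding expected_LDS_eq
  proof (rule code_expect_mono)
    fix a
    show "real m * (1 - (\<Prod>s<g. f s a)) \<le> real (code_LDS n a)"
    proof (cases "\<exists>s<g. \<forall>j<m. hit m \<tau> s j a")
      case True
      then obtain s where s: "s < g" "\<forall>j<m. hit m \<tau> s j a" by blast
      then have "{j. j < m \<and> hit m \<tau> s j a} = {..<m}" by auto
      then have "m \<le> code_LDS n a" using card_hits_le_code_LDS[OF n s(1), of a] by simp
      moreover have "0 \<le> (\<Prod>s<g. f s a)" using f01 by (intro prod_nonneg) auto
      ultimately show ?thesis using mult_left_le[of "1 - (\<Prod>s<g. f s a)" "real m"] by simp
    next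
      case False
      have "f s a = 1" if sg: "s < g" for s
      proof -
        obtain j where "j < m" "\<not> hit m \<tau> s j a" using False sg by blast
        then have "(\<Prod>j<m. ?h s j a) = 0" by (intro prod_zero) auto
        then show ?thesis by (simp add: f_def)
      qed
      then have "(\<Prod>s<g. f s a) = 1" by (intro prod.neutral) auto
      then show ?thesis by simp
    qed
  qed (use q in simp)
  finally show "real m * (1 - (1 - \<sigma> ^ m) ^ g) \<le> expected_LDS n q" .
qed

section \<open>Crude bounds and the range \<open>q \<le> 1 / n\<close>\<close>

lemma expected_LDS_ge_1:
  assumes "0 < q" "1 \<le> n"
  shows "1 \<le> expected_LDS n q"
proof -
  have "1 = code_expect q {1..n} (\<lambda>_. 1)" using assms by (simp add: code_expect_const)
  also have "\<dots> \<le> expected_LDS n q"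
    unfolding expected_LDS_eq using assms code_LDS_ge_1[of n] by (intro code_expect_mono) auto
  finally show ?thesis .
qed

lemma expected_LDS_le:
  assumes "0 < q"
  shows "expected_LDS n q \<le> real n"
proof -
  have "expected_LDS n q \<le> code_expect q {1..n} (\<lambda>_. real n)"
    unfolding expected_LDS_eq using assms code_LDS_le by (intro code_expect_mono) auto
  also have "\<dots> = real n" using assms by (simp add: code_expect_const)
  finally show ?thesis .
qed

text \<open>Every entry of a chain after the first has a positive code value, and each code value is
  positive with probability at most \<open>q\<close>.\<close>

lemma expected_LDS_upper_small:
  assumes q: "0 < q" "q < 1"
  shows "expected_LDS n q - 1 \<le> real n * q"
proof -
  have le: "real (code_LDS n a) \<le> 1 + (\<Sum>i\<in>{1..n}. of_bool (0 < a i))" for a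
  proof -
    obtain I where I: "I \<subseteq> {1..n}" "dec_chain a I" "card I = code_LDS n a"
      using code_LDS_witness by blast
    have fin: "finite I" using I(1) finite_subset by blast
    have "I - {Min I} \<subseteq> {1..n} \<inter> {i. 0 < a i}"
    proof
      fix j assume j: "j \<in> I - {Min I}"
      then have "Min I \<in> I" using Min_in[OF fin] by auto
      moreover have "Min I < j" using Min_le[OF fin, of j] j by (simp add: order_less_le)
      ultimately have "rk a (Min I) (j - 1 - Min I) < a j" using I(2) j by (auto simp: dec_chain_def)
      then show "j \<in> {1..n} \<inter> {i. 0 < a i}" using j I(1) by auto
    qed
    then have "card (I - {Min I}) \<le> card ({1..n} \<inter> {i. 0 < a i})" by (intro card_mono) auto
    moreover have "card I \<le> Suc (card (I - {Min I}))" using card_Suc_Diff1[of I "Min I"] fin Min_in[OF fin]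
      by (cases "I = {}") auto
    ultimately show ?thesis using I(3) by (simp add: sum_of_bool_eq)
  qed
  have single: "code_expect q {1..n} (\<lambda>a. of_bool (0 < a i)) \<le> q" if i: "i \<in> {1..n}" for i
  proof -
    have "code_expect q {1..n} (\<lambda>a. of_bool (0 < a i)) = code_expect q {i} (\<lambda>a. of_bool (0 < a i))"
      using q i by (intro code_expect_superset) (auto simp: depends_on_def)
    also have "\<dots> = (\<Sum>k<i. geo q i k * of_bool (0 < k))"
      by (simp add: code_expect_insert code_expect_empty)
    also have "\<dots> = (\<Sum>k<i. geo q i k - (if k = 0 then geo q i 0 else 0))"
      by (intro sum.cong) auto
    also have "\<dots> = 1 - geo q i 0"
      using sum_geo[of q i] q i by (simp add: sum_subtractf)
    also have "geo q i 0 = (1 - q) / (1 - q ^ i)" using q by (simp add: geo_eq)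
    also have "1 - \<dots> \<le> 1 - (1 - q)"
    proof -
      have "0 < 1 - q ^ i" using one_minus_power_pos[OF q, of i] i by simp
      then have "(1 - q) * (1 - q ^ i) \<le> 1 - q" "0 < 1 - q ^ i" using q by (auto intro: mult_left_le)
      then have "1 - q \<le> (1 - q) / (1 - q ^ i)" by (simp add: pos_le_divide_eq)
      then show ?thesis by linarith
    qed
    finally show ?thesis by simp
  qed
  have "expected_LDS n q \<le> code_expect q {1..n} (\<lambda>a. 1 + (\<Sum>i\<in>{1..n}. of_bool (0 < a i)))"
    unfolding expected_LDS_eq using q le by (intro code_expect_mono) auto
  also have "\<dots> = 1 + (\<Sum>i\<in>{1..n}. code_expect q {1..n} (\<lambda>a. of_bool (0 < a i)))"
    using q by (simp only: code_expect_add code_expect_sum) (simp add: code_expect_const)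
  also have "\<dots> \<le> 1 + (\<Sum>i\<in>{1..n}. q)" by (intro add_left_mono sum_mono single)
  finally show ?thesis by simp
qed

text \<open>The length is at least 2 unless all code values vanish. That event has probability at
  most \<open>(1 + q) ^ -(n - 1)\<close>, which is at most \<open>1 - x / 2\<close> for
  \<open>x = (n - 1) q \<le> 1\<close>; finally \<open>n - 1 \<ge> n / 2\<close>.\<close>

lemma expected_LDS_lower_small:
  assumes q: "0 < q" "q < 1" and n: "2 \<le> n" and nq: "real n * q \<le> 1"
  shows "real n * q / 4 \<le> expected_LDS n q - 1"
proof -
  have ge: "2 - (\<Prod>i\<in>{1..n}. of_bool (a i = 0)) \<le> real (code_LDS n a)"
    if a: "a \<in> PiE {1..n} (\<lambda>i. {..<i})" for a
  proof (cases "\<forall>i\<in>{1..n}. a i = 0")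
    case True
    then have "(\<Prod>i\<in>{1..n}. of_bool (a i = 0) :: real) = 1" by (intro prod.neutral) auto
    then show ?thesis using code_LDS_ge_1[of n a] n by simp
  next
    case False
    \<comment> \<open>The first position with a nonzero code value follows one with code value 0, so
      these two adjacent positions form a descent.\<close>
    define Q where "Q i \<longleftrightarrow> i \<in> {1..n} \<and> a i \<noteq> 0" for i
    have "\<exists>i. Q i" using False by (auto simp: Q_def)
    then obtain i where Qi: "Q i" and "\<forall>k<i. \<not> Q k" using exists_least_iff[of Q] by blast
    then have i: "i \<in> {1..n} \<and> a i \<noteq> 0" and least: "\<And>k. k \<in> {1..n} \<Longrightarrow> k < i \<Longrightarrow> a k = 0"
      by (auto simp: Q_def)
    have "a 1 = 0" using PiE_mem[OF a, of 1] n by simp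
    moreover have "a i \<noteq> 0" using i by blast
    ultimately have "i \<noteq> 1" by metis
    then have i2: "2 \<le> i" using i by simp
    then obtain k where k: "i = Suc k" "1 \<le> k" by (metis Suc_1 Suc_le_D Suc_le_mono One_nat_def)
    have "a k = 0" using i k by (intro least) auto
    then have "rk a k 0 < a (Suc k)" using i k by simp
    then have "dec_chain a {k, Suc k}" unfolding dec_chain_def by (simp del: rk.simps)
    moreover have "{k, Suc k} \<subseteq> {1..n}" using i k by auto
    ultimately have "card {k, Suc k} \<le> code_LDS n a" by (intro card_le_code_LDS)
    moreover have "card {k, Suc k} = 2" by simp
    moreover have "0 \<le> (\<Prod>i\<in>{1..n}. of_bool (a i = 0) :: real)" by (intro prod_nonneg) auto
    ultimately show ?thesis by linarith
  qed
  have P: "code_expect q {1..n} (\<lambda>a. \<Prod>i\<in>{1..n}. of_bool (a i = 0)) \<le> 1 / (1 + q) ^ (n - 1)"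
  proof -
    have "code_expect q {1..n} (\<lambda>a. \<Prod>i\<in>{1..n}. of_bool (a i = 0)) =
        (\<Prod>i\<in>{1..n}. code_expect q {i} (\<lambda>a. of_bool (a i = 0)))"
      using code_expect_prod[of "{1..n}" "\<lambda>i. {i}" "\<lambda>i a. of_bool (a i = 0)" q]
      by (simp add: disjoint_family_on_def depends_on_def)
    also have "\<dots> = (\<Prod>i\<in>{1..n}. geo q i 0)"
    proof (rule prod.cong)
      fix i assume "i \<in> {1..n}"
      have "code_expect q {i} (\<lambda>a. of_bool (a i = 0)) = (\<Sum>k<i. if k = 0 then geo q i 0 else 0)"
        by (auto simp: code_expect_insert code_expect_empty intro!: sum.cong)
      then show "code_expect q {i} (\<lambda>a. of_bool (a i = 0)) = geo q i 0" using \<open>i \<in> {1..n}\<close> by simp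
    qed simp
    \<comment> \<open>At position 1 the code value is always 0, hence the exponent
      \<open>n - 1\<close>.\<close>
    also have "\<dots> = (\<Prod>i\<in>{2..n}. geo q i 0)"
    proof -
      have "{1..n} = insert 1 {2..n}" using n by auto
      then show ?thesis by (simp add: geo_def)
    qed
    also have "\<dots> \<le> (\<Prod>i\<in>{2..n}. 1 / (1 + q))"
    proof (rule prod_mono)
      fix i assume i: "i \<in> {2..n}"
      have "1 + q = (\<Sum>k<2. q ^ k)" by (simp add: numeral_2_eq_2)
      also have "\<dots> \<le> (\<Sum>k<i. q ^ k)" using i q by (intro sum_mono2) auto
      finally have "1 / (\<Sum>k<i. q ^ k) \<le> 1 / (1 + q)" using q by (intro divide_left_mono) auto
      then show "0 \<le> geo q i 0 \<and> geo q i 0 \<le> 1 / (1 + q)" using q by (simp add: geo_def sum_nonneg)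
    qed
    also have "\<dots> = 1 / (1 + q) ^ (n - 1)" by (simp add: power_divide)
    finally show ?thesis .
  qed
  define x where "x = real (n - 1) * q"
  have x: "real n * q / 2 \<le> x" "x \<le> 1" "0 \<le> x"
  proof -
    have "real n / 2 * q \<le> real (n - 1) * q" using n q by (intro mult_right_mono) auto
    then show "real n * q / 2 \<le> x" by (simp add: x_def)
    have "real (n - 1) * q \<le> real n * q" using q by (intro mult_right_mono) auto
    then show "x \<le> 1" using nq by (simp add: x_def)
    show "0 \<le> x" using q by (simp add: x_def)
  qed
  have "1 + x \<le> (1 + q) ^ (n - 1)" unfolding x_def using q by (intro Bernoulli_inequality) auto
  then have "1 / (1 + q) ^ (n - 1) \<le> 1 / (1 + x)" using x q by (intro divide_left_mono) auto
  also have "\<dots> \<le> 1 - x / 2"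
  proof -
    have "x * x \<le> x * 1" using x by (intro mult_left_mono) auto
    then have "1 \<le> (1 - x / 2) * (1 + x)" by (simp add: algebra_simps)
    then show ?thesis using x by (simp add: pos_divide_le_eq)
  qed
  finally have P': "1 / (1 + q) ^ (n - 1) \<le> 1 - x / 2" .
  have "2 - code_expect q {1..n} (\<lambda>a. \<Prod>i\<in>{1..n}. of_bool (a i = 0)) = code_expect q {1..n} (\<lambda>a. 2 - (\<Prod>i\<in>{1..n}. of_bool (a i = 0)))"
    using q by (simp only: code_expect_diff) (simp add: code_expect_const)
  also have "\<dots> \<le> expected_LDS n q"
    unfolding expected_LDS_eq using q ge by (intro code_expect_mono) auto
  finally show ?thesis using P P' x by simp
qed

lemma expected_LDS_upper_gaussian:
  assumes q: "0 < q" "q < 1"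
  shows "expected_LDS n q \<le> real m + real n * (real n / (1 - q) * (q ^ (\<Sum>{..m}) / (1 - q) ^ (2 * m)))"
proof -
  have "pot_tail q n m 0 \<le> q ^ (\<Sum>{..m}) / (1 - q) ^ (2 * m)"
    using pot_tail_le_gaussian[OF q, of n m 0] by simp
  then have "real m + real n * (real n / (1 - q) * pot_tail q n m 0) \<le>
      real m + real n * (real n / (1 - q) * (q ^ (\<Sum>{..m}) / (1 - q) ^ (2 * m)))"
    using q by (intro add_left_mono mult_left_mono) auto
  with expected_LDS_upper[OF q, of n m] show ?thesis by linarith
qed

lemma expected_LDS_upper_factorial:
  assumes q: "0 < q" "q < 1"
  shows "expected_LDS n q \<le> real m + real n * (real n / (1 - q) * ((16 / (1 - q)) ^ m / (fact m)\<^sup>2))"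
proof -
  have "real m + real n * (real n / (1 - q) * pot_tail q n m 0) \<le>
      real m + real n * (real n / (1 - q) * ((16 / (1 - q)) ^ m / (fact m)\<^sup>2))"
    using q pot_tail_le_factorial_sq[OF q, of n m] by (intro add_left_mono mult_left_mono) auto
  with expected_LDS_upper[OF q, of n m] show ?thesis by linarith
qed

section \<open>The regimes\<close>

lemma power_eq_exp_ln: "0 < x \<Longrightarrow> x ^ k = exp (real k * ln x)"
  by (simp add: exp_of_nat_mult)

lemma nat_ceiling_bounds:
  fixes x :: real
  assumes "0 \<le> x"
  shows "x \<le> real (nat \<lceil>x\<rceil>)" "real (nat \<lceil>x\<rceil>) \<le> x + 1"
proof -
  have "real (nat \<lceil>x\<rceil>) = of_int \<lceil>x\<rceil>" using assms by (simp add: of_nat_nat)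
  then show "x \<le> real (nat \<lceil>x\<rceil>)" "real (nat \<lceil>x\<rceil>) \<le> x + 1" by linarith+
qed

lemma ln_3_ge_1: "1 \<le> ln (3::real)"
  using exp_le by (simp add: ln_ge_iff)

lemma ln_inverse_le:
  fixes q :: real
  assumes "1 / 2 \<le> q" "q < 1"
  shows "ln (1 / q) \<le> 2 * (1 - q)"
proof -
  have "ln (1 / q) \<le> 1 / q - 1" using assms by (intro ln_le_minus_one) auto
  also have "\<dots> = (1 - q) / q" using assms by (simp add: field_simps)
  also have "\<dots> \<le> (1 - q) / (1 / 2)" using assms by (intro divide_left_mono) auto
  finally show ?thesis by simp
qed

lemma ln_inverse_ge:
  fixes q :: real
  assumes "0 < q"
  shows "1 - q \<le> ln (1 / q)"
  using ln_le_minus_one[of q] assms by (simp add: ln_div)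

lemma power_div_fact_le_exp: "real m ^ m / fact m \<le> exp (real m)"
proof -
  have "real m ^ m / fact m = (\<Sum>k\<in>{m}. real m ^ k /\<^sub>R fact k)"
    by (simp add: divide_inverse mult.commute)
  also have "\<dots> \<le> (\<Sum>k. real m ^ k /\<^sub>R fact k)"
    by (intro sum_le_suminf summable_exp_generic) auto
  finally show ?thesis by (simp add: exp_def)
qed

text \<open>From \<open>fact m \<ge> (m / 3) ^ m\<close> the quotient is at most
  \<open>(144 / (v m^2)) ^ m\<close> with \<open>144 = 16 * 9\<close>. The parameter
  \<open>z\<close> is the decay rate wanted per step: \<open>exp 1\<close> in the first range and a
  square root in the second.\<close>

lemma power_div_fact_sq_le_exp:
  assumes v: "0 < v" and z: "0 < z" "144 * z \<le> v * (real m)\<^sup>2"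
  shows "(16 / v) ^ m / (fact m)\<^sup>2 \<le> exp (- (real m * ln z))"
proof -
  have m: "0 < m"
  proof (rule ccontr)
    assume "\<not> 0 < m" then show False using z by simp
  qed
  have "real m ^ m \<le> exp 1 ^ m * fact m"
    using power_div_fact_le_exp[of m] by (simp add: field_simps exp_of_nat_mult[symmetric])
  also have "\<dots> \<le> 3 ^ m * fact m"
    using exp_le by (intro mult_right_mono power_mono) auto
  finally have "(real m / 3) ^ m \<le> fact m" by (simp add: power_divide field_simps)
  then have "((real m / 3) ^ m)\<^sup>2 \<le> (fact m)\<^sup>2" by (intro power_mono) auto
  also have "((real m / 3) ^ m)\<^sup>2 = ((real m)\<^sup>2 / 9) ^ m"
  proof -
    have "((real m / 3) ^ m)\<^sup>2 = ((real m / 3)\<^sup>2) ^ m" by (simp only: power_mult[symmetric] mult.commute)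
    then show ?thesis by (simp add: power_divide[of _ _ 2])
  qed
  finally have f: "((real m)\<^sup>2 / 9) ^ m \<le> (fact m)\<^sup>2" .
  have "(16 / v) ^ m / (fact m)\<^sup>2 \<le> (16 / v) ^ m / ((real m)\<^sup>2 / 9) ^ m"
    using f m v by (intro divide_left_mono mult_pos_pos) auto
  also have "\<dots> = (144 / (v * (real m)\<^sup>2)) ^ m"
    by (simp add: power_divide[symmetric])
  also have "\<dots> \<le> (1 / z) ^ m"
    using v z m by (intro power_mono) (auto simp: field_simps)
  also have "\<dots> = exp (- (real m * ln z))"
    using z by (simp add: power_eq_exp_ln[of "1 / z"] ln_div)
  finally show ?thesis .
qed

section \<open>Upper bounds in the three ranges\<close>

text \<open>\<open>m\<close> is about \<open>24 / sqrt v\<close>: then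
  \<open>v m^2 \<ge> 576 = 4 * 144\<close> allows \<open>z = exp 1\<close>, and
  \<open>v L^2 \<le> 3\<close> gives \<open>m \<ge> 12 L\<close>. The tail \<open>exp (- m)\<close>
  beats the prefactor, which is at most \<open>n^3\<close> because
  \<open>1 / v \<le> n\<close>.\<close>

lemma expected_LDS_le_sqrt:
  assumes n: "2 \<le> n" and q: "0 < q" "q < 1" and r: "1 - 3 / (ln n)\<^sup>2 \<le> q" "q \<le> 1 - 4 / real n"
  shows "expected_LDS n q \<le> 26 * (1 / sqrt (1 - q))"
proof -
  define v L where "v = 1 - q" and "L = ln (real n)"
  have L: "0 < L" using n by (simp add: L_def)
  have v: "0 < v" "v < 1" "v \<le> 3 / L\<^sup>2" "4 / real n \<le> v" using q r by (auto simp: v_def L_def)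
  have s1: "1 \<le> 1 / sqrt v" using v by (simp add: real_sqrt_le_1_iff)
  define m where "m = nat \<lceil>24 / sqrt v\<rceil>"
  have m: "24 / sqrt v \<le> real m" "real m \<le> 24 / sqrt v + 1"
    unfolding m_def using nat_ceiling_bounds[of "24 / sqrt v"] v by auto
  have "(24 / sqrt v)\<^sup>2 \<le> (real m)\<^sup>2" using m v by (intro power_mono) auto
  then have "576 \<le> v * (real m)\<^sup>2" using v by (simp add: power_divide field_simps)
  then have t: "(16 / v) ^ m / (fact m)\<^sup>2 \<le> exp (- (real m * ln (exp 1)))"
    using exp_le v by (intro power_div_fact_sq_le_exp) auto
  have "L\<^sup>2 * v \<le> 3" using v L by (simp add: field_simps)
  then have "L\<^sup>2 * v \<le> 4" by simp
  then have "sqrt (L\<^sup>2 * v) \<le> sqrt 4" by (rule real_sqrt_le_mono)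
  then have "L * sqrt v \<le> 2" using L by (simp add: real_sqrt_mult)
  then have "12 * L \<le> 24 / sqrt v" using v by (simp add: field_simps)
  then have mL: "12 * L \<le> real m" using m by linarith
  have nL: "real n = exp L" using n by (simp add: L_def)
  have "1 / v \<le> real n"
    using v n by (simp add: field_simps)
  have "real n * (real n / v * ((16 / v) ^ m / (fact m)\<^sup>2)) \<le> real n * (real n * real n * exp (- (12 * L)))"
  proof -
    have "real n / v \<le> real n * real n" using \<open>1 / v \<le> real n\<close> n mult_left_mono[of "1 / v" "real n" "real n"] by simp
    moreover have "(16 / v) ^ m / (fact m)\<^sup>2 \<le> exp (- (12 * L))"
      using t mL by (simp add: order_trans)
    ultimately show ?thesis using v by (intro mult_left_mono mult_mono) auto
  qed
  also have "\<dots> = exp (3 * L - 12 * L)" unfolding nL by (simp add: exp_add[symmetric] exp_diff field_simps)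
  also have "\<dots> \<le> 1" using L by simp
  finally have "expected_LDS n q \<le> real m + 1"
    using expected_LDS_upper_factorial[OF q, of n m] unfolding v_def by linarith
  also have "\<dots> \<le> 26 * (1 / sqrt v)" using m s1 by simp
  finally show ?thesis by (simp add: v_def)
qed

text \<open>\<open>m\<close> is about \<open>48 b\<close> and \<open>z = sqrt y\<close>, so the tail
  is at most \<open>exp (- m * ln y / 2) \<le> exp (- 24 L)\<close>, against a prefactor of at most
  \<open>exp (4 L)\<close>. The bound \<open>b \<ge> 1 / 2\<close> absorbs the rounding.\<close>

lemma expected_LDS_le_log:
  assumes n: "2 \<le> n" and q: "0 < q" "q < 1" and r: "q \<le> 1 - 3 / (ln n)\<^sup>2"
  shows "expected_LDS n q \<le> 52 * (ln n / ln ((1 - q) * (ln n)\<^sup>2))"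
proof -
  define v L where "v = 1 - q" and "L = ln (real n)"
  define y where "y = v * L\<^sup>2"
  have L: "0 < L" using n by (simp add: L_def)
  have v: "0 < v" "v < 1" "3 / L\<^sup>2 \<le> v" using q r by (auto simp: v_def L_def)
  then have y: "3 \<le> y" using L by (simp add: y_def field_simps)
  have lny: "1 \<le> ln y" using y ln_3_ge_1 ln_mono[of 3 y] by linarith
  define b where "b = L / ln y"
  have "y \<le> L\<^sup>2" using v L by (simp add: y_def mult_left_le_one_le)
  then have "ln y \<le> ln (L\<^sup>2)" using y L by (intro ln_mono) auto
  also have "\<dots> = 2 * ln L" using L by (simp add: ln_realpow)
  also have "\<dots> \<le> 2 * L" using ln_le_minus_one[OF L] by simp
  finally have b: "1 / 2 \<le> b" using lny by (simp add: b_def field_simps)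
  define m where "m = nat \<lceil>48 * b\<rceil>"
  have m: "48 * b \<le> real m" "real m \<le> 48 * b + 1"
    unfolding m_def using nat_ceiling_bounds[of "48 * b"] b by auto
  have z: "144 * sqrt y \<le> v * (real m)\<^sup>2"
  proof -
    \<comment> \<open>A logarithm is at most its argument, here the fourth root of \<open>y\<close>;
      thus \<open>(ln y)^2 \<le> 16 * sqrt y\<close>, and \<open>2304 = 144 * 16\<close>.\<close>
    have "ln y = 4 * ln (sqrt (sqrt y))" using y by (simp add: ln_sqrt)
    also have "\<dots> \<le> 4 * sqrt (sqrt y)" using y ln_le_minus_one[of "sqrt (sqrt y)"] by simp
    finally have "(ln y)\<^sup>2 \<le> (4 * sqrt (sqrt y))\<^sup>2" using lny by (intro power_mono) auto
    also have "\<dots> = 16 * sqrt y" using y by (simp add: power_mult_distrib)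
    finally have "144 * sqrt y * (ln y)\<^sup>2 \<le> 144 * sqrt y * (16 * sqrt y)" using y by (intro mult_left_mono) auto
    also have "\<dots> = 2304 * y" using y by simp
    finally have "144 * sqrt y \<le> 2304 * y / (ln y)\<^sup>2" using lny by (simp add: field_simps)
    also have "\<dots> = v * (48 * b)\<^sup>2" by (simp add: b_def y_def power_mult_distrib power_divide)
    also have "\<dots> \<le> v * (real m)\<^sup>2" using v m b by (intro mult_left_mono power_mono) auto
    finally show ?thesis .
  qed
  have t: "(16 / v) ^ m / (fact m)\<^sup>2 \<le> exp (- (real m * ln (sqrt y)))"
    using v y z by (intro power_div_fact_sq_le_exp) auto
  have "24 * L = 48 * b * (ln y / 2)" using lny by (simp add: b_def)
  also have "\<dots> \<le> real m * (ln y / 2)" using m lny by (intro mult_right_mono) auto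
  also have "\<dots> = real m * ln (sqrt y)" using y by (simp add: ln_sqrt)
  finally have t': "(16 / v) ^ m / (fact m)\<^sup>2 \<le> exp (- (24 * L))" using t by (simp add: order_trans)
  have nL: "real n = exp L" using n by (simp add: L_def)
  have "1 / v \<le> L\<^sup>2" using v L by (simp add: field_simps)
  also have "\<dots> \<le> (exp L)\<^sup>2" using L exp_ge_add_one_self[of L] by (intro power_mono) linarith+
  finally have v': "1 / v \<le> exp L * exp L" by (simp add: power2_eq_square)
  have "real n * (real n / v * ((16 / v) ^ m / (fact m)\<^sup>2)) \<le> exp L * (exp L * (exp L * exp L) * exp (- (24 * L)))"
  proof -
    have "real n / v \<le> exp L * (exp L * exp L)" using mult_left_mono[OF v', of "exp L"] nL by simp
    then show ?thesis using v t' unfolding nL by (intro mult_left_mono mult_mono) auto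
  qed
  also have "\<dots> = exp (4 * L - 24 * L)" by (simp add: exp_add[symmetric] exp_diff field_simps)
  also have "\<dots> \<le> 1" using L by simp
  finally have "expected_LDS n q \<le> real m + 1"
    using expected_LDS_upper_factorial[OF q, of n m] unfolding v_def by linarith
  also have "\<dots> \<le> 52 * b" using m b by simp
  finally show ?thesis by (simp add: v_def L_def b_def y_def)
qed

text \<open>Applied with \<open>L = ln n\<close> and \<open>l = ln (1 / q)\<close>: it controls the
  polynomial losses \<open>(1 / (1 - q)) ^ m\<close> in the third range. The absolute value covers
  \<open>n = 2\<close>, where \<open>ln L\<close> is negative.\<close>

lemma sqrt_div_mult_ln_le:
  fixes L l :: real
  assumes L: "0 < L" and l: "0 < l" "(ln L)\<^sup>2 / L \<le> l"
  shows "sqrt (L / l) * \<bar>ln L\<bar> \<le> L"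
proof -
  have "(ln L)\<^sup>2 \<le> L * l" using L l by (simp add: field_simps)
  then have "sqrt ((ln L)\<^sup>2) \<le> sqrt (L * l)" by (rule real_sqrt_le_mono)
  then have "sqrt (L / l) * \<bar>ln L\<bar> \<le> sqrt (L / l) * sqrt (L * l)" using L l by (intro mult_left_mono) auto
  also have "\<dots> = sqrt (L * L)" unfolding real_sqrt_mult[symmetric] using l by simp
  also have "\<dots> = L" using L by simp
  finally show ?thesis .
qed

text \<open>\<open>m\<close> is about \<open>10 b\<close>, where
  \<open>b^2 * ln (1 / q) = L\<close>. The Gaussian factor is at most \<open>exp (- 50 L)\<close>,
  while \<open>v ^ (2 m) \<ge> exp (- 22 L)\<close> by \<open>m \<le> 11 b\<close> and
  \<open>b * ln L \<le> L\<close>. The remaining \<open>exp (- 28 L)\<close> beats the prefactor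
  \<open>exp (3 L)\<close>.\<close>

lemma expected_LDS_le_sqrt_log:
  assumes n: "2 \<le> n" and q: "0 < q" "q < 1"
    and r: "1 / real n \<le> q" "q \<le> 1 - 1 * (ln (ln n))\<^sup>2 / ln n"
  shows "expected_LDS n q \<le> 27 * sqrt (ln n / ln (1 / q))"
proof -
  define v L where "v = 1 - q" and "L = ln (real n)"
  define b where "b = sqrt (L / ln (1 / q))"
  have L: "0 < L" using n by (simp add: L_def)
  have v: "0 < v" "v < 1" "(ln L)\<^sup>2 / L \<le> v" using q r by (auto simp: v_def L_def)
  have lq: "v \<le> ln (1 / q)" using ln_inverse_ge q by (simp add: v_def)
  have "1 / q \<le> real n" using r n q by (simp add: field_simps)
  then have "ln (1 / q) \<le> L" using q n by (simp add: L_def)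
  then have b1: "1 \<le> b" using lq v by (simp add: b_def)
  have "expected_LDS n q \<le> 27 * b"
  \<comment> \<open>For \<open>n \<ge> 27 = 3 ^ 3\<close> one has \<open>L \<ge> 3\<close> and so
    \<open>ln L \<ge> 1\<close>. Smaller \<open>n\<close> are covered by the trivial bound
    \<open>n\<close>, as \<open>b \<ge> 1\<close>.\<close>
  proof (cases "n < 27")
    case True
    then have "expected_LDS n q \<le> 27" using expected_LDS_le[of q n] q by linarith
    then show ?thesis using b1 by simp
  next
    case False
    have "3 * ln 3 = ln ((3::real) ^ 3)" by (simp add: ln_realpow del: power_numeral)
    also have "\<dots> \<le> L" unfolding L_def using False by (intro ln_mono) auto
    finally have L3: "3 \<le> L" using ln_3_ge_1 by linarith
    then have l1: "1 \<le> ln L" using exp_le by (simp add: ln_ge_iff)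
    have "1 / L \<le> (ln L)\<^sup>2 / L" using l1 L by (intro divide_right_mono) auto
    then have vL: "1 / L \<le> v" using v by linarith
    have lv: "- ln v \<le> ln L"
    proof -
      have "ln (1 / L) \<le> ln v" using vL L by (intro ln_mono) auto
      then show ?thesis using L by (simp add: ln_div)
    qed
    have bL: "b * ln L \<le> L"
    proof -
      have "(ln L)\<^sup>2 / L \<le> ln (1 / q)" using v lq by linarith
      then show ?thesis using sqrt_div_mult_ln_le[OF L, of "ln (1 / q)"] lq v l1 by (simp add: b_def)
    qed
    have bsq: "b\<^sup>2 * ln (1 / q) = L" using lq v L by (simp add: b_def)
    define m where "m = nat \<lceil>10 * b\<rceil>"
    have m: "10 * b \<le> real m" "real m \<le> 10 * b + 1"
      unfolding m_def using nat_ceiling_bounds[of "10 * b"] b1 by auto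
    have tri: "(real m)\<^sup>2 / 2 \<le> real (\<Sum>{..m})"
      by (induction m) (auto simp: power2_eq_square field_simps)
    have "50 * L = (10 * b)\<^sup>2 / 2 * ln (1 / q)" using bsq by (simp add: power_mult_distrib)
    also have "\<dots> \<le> (real m)\<^sup>2 / 2 * ln (1 / q)"
      using m b1 lq v by (intro mult_right_mono divide_right_mono power_mono) auto
    also have "\<dots> \<le> real (\<Sum>{..m}) * ln (1 / q)" using tri lq v by (intro mult_right_mono) auto
    finally have "50 * L \<le> - (real (\<Sum>{..m}) * ln q)" using q by (simp add: ln_div)
    then have e1: "q ^ (\<Sum>{..m}) \<le> exp (- (50 * L))" using q by (simp add: power_eq_exp_ln)
    have "real (2 * m) * - ln v \<le> real (2 * m) * ln L" using lv by (intro mult_left_mono) auto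
    also have "\<dots> \<le> 22 * b * ln L" using m b1 l1 by (intro mult_right_mono) auto
    also have "\<dots> \<le> 22 * L" using bL by simp
    finally have e2: "exp (- (22 * L)) \<le> v ^ (2 * m)" using v by (simp add: power_eq_exp_ln)
    have "q ^ (\<Sum>{..m}) / v ^ (2 * m) \<le> exp (- (50 * L)) / exp (- (22 * L))"
      using e1 e2 by (intro frac_le) auto
    also have "\<dots> = exp (- (28 * L))" by (simp add: exp_diff[symmetric])
    finally have t: "q ^ (\<Sum>{..m}) / v ^ (2 * m) \<le> exp (- (28 * L))" .
    have nL: "real n = exp L" using n by (simp add: L_def)
    have "1 / v \<le> L" using vL v L by (simp add: field_simps)
    also have "\<dots> \<le> exp L" using exp_ge_add_one_self[of L] by linarith
    finally have v': "1 / v \<le> exp L" .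
    have "real n * (real n / v * (q ^ (\<Sum>{..m}) / v ^ (2 * m))) \<le> exp L * (exp L * exp L * exp (- (28 * L)))"
    proof -
      have "real n / v \<le> exp L * exp L" using mult_left_mono[OF v', of "exp L"] nL by simp
      then show ?thesis using v q t unfolding nL by (intro mult_left_mono mult_mono) auto
    qed
    also have "\<dots> = exp (3 * L - 28 * L)" by (simp add: exp_add[symmetric] exp_diff field_simps)
    also have "\<dots> \<le> 1" using L by simp
    finally have "expected_LDS n q \<le> real m + 1"
      using expected_LDS_upper_gaussian[OF q, of n m] unfolding v_def by linarith
    also have "\<dots> \<le> 27 * b" using m b1 by simp
    finally show ?thesis .
  qed
  then show ?thesis by (simp add: b_def L_def)
qed

section \<open>Lower bounds in the three ranges\<close>

text \<open>From \<open>(1 - x) ^ k \<le> exp (- k x) \<le> 1 / (1 + k x)\<close>. It bounds the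
  chance of a success among \<open>k\<close> trials, both for the positions of a block and for the
  runs.\<close>

lemma min_le_one_minus_power:
  fixes x :: real
  assumes x: "0 \<le> x" "x \<le> 1"
  shows "min 1 (real k * x) / 2 \<le> 1 - (1 - x) ^ k"
proof -
  have "(1 - x) ^ k \<le> exp (- x) ^ k" using x exp_ge_add_one_self[of "- x"] by (intro power_mono) auto
  also have "\<dots> = 1 / exp (real k * x)" by (simp add: exp_of_nat_mult exp_minus divide_inverse power_inverse)
  also have "\<dots> \<le> 1 / (1 + real k * x)"
    using x exp_ge_add_one_self[of "real k * x"] by (intro divide_left_mono mult_pos_pos) (auto intro: add_pos_nonneg)
  finally have *: "(1 - x) ^ k \<le> 1 / (1 + real k * x)" .
  define y where "y = real k * x"
  have y: "0 \<le> y" using x by (simp add: y_def)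
  have "min 1 y / 2 \<le> y / (1 + y)"
  proof (cases "y \<le> 1")
    case True
    then have "y / 2 \<le> y / (1 + y)" using y by (intro divide_left_mono) auto
    then show ?thesis using True by simp
  next
    case False
    then show ?thesis by (simp add: field_simps)
  qed
  also have "\<dots> = 1 - 1 / (1 + y)" using y by (simp add: field_simps)
  finally show ?thesis using * unfolding y_def by linarith
qed

text \<open>\<open>\<tau>\<close> is the largest block length with
  \<open>\<tau> m (1 - q) \<le> 1\<close>. This keeps \<open>q ^ (3 * \<tau> * m)\<close> above
  \<open>exp (- 6)\<close>, so a block has at least of order \<open>\<tau>^2 (1 - q)\<close>, that
  is \<open>1 / (m^2 (1 - q))\<close>, expected hits.\<close>

lemma planting_probability:
  fixes q :: real and m :: nat
  assumes q: "1 / 2 \<le> q" "q < 1" and m: "1 \<le> m" "real m * (1 - q) \<le> 1"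
  defines "\<tau> \<equiv> nat \<lfloor>1 / (real m * (1 - q))\<rfloor>"
  defines "\<sigma> \<equiv> 1 - (1 - real \<tau> * ((1 - q) * q ^ (3 * \<tau> * m))) ^ \<tau>"
  shows "1 \<le> \<tau>" "real (\<tau> * m) \<le> 1 / (1 - q)" "\<sigma> \<le> 1" "min 1 (1 / (3000 * (real m)\<^sup>2 * (1 - q))) / 2 \<le> \<sigma>"
proof -
  define v where "v = 1 - q"
  have v: "0 < v" "v \<le> 1 / 2" using q by (auto simp: v_def)
  define z where "z = 1 / (real m * v)"
  have mv: "0 < real m * v" using m v by simp
  have z: "1 \<le> z" using m mv by (simp add: z_def v_def)
  have t: "real \<tau> \<le> z" "z - 1 < real \<tau>"
    unfolding \<tau>_def v_def[symmetric] z_def[symmetric] using z by (auto simp: of_nat_nat)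
  have "1 \<le> \<lfloor>z\<rfloor>" using z by simp
  then show t1: "1 \<le> \<tau>" unfolding \<tau>_def v_def[symmetric] z_def[symmetric] by linarith
  have tz: "z / 2 \<le> real \<tau>"
  proof (cases "z \<le> 2")
    case True
    then show ?thesis using t1 by simp
  next
    case False
    then show ?thesis using t by simp
  qed
  have tmv: "real \<tau> * real m * v \<le> 1"
    using mult_right_mono[OF t(1), of "real m * v"] mv m v by (simp add: z_def mult.assoc)
  then show "real (\<tau> * m) \<le> 1 / (1 - q)" using v by (simp add: v_def field_simps)
  have "real (3 * \<tau> * m) * - ln q \<le> 6"
  proof -
    have "real (3 * \<tau> * m) * - ln q \<le> real (3 * \<tau> * m) * (2 * v)"
      using ln_inverse_le[OF q] q by (intro mult_left_mono) (auto simp: v_def ln_div)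
    also have "\<dots> = 6 * (real \<tau> * real m * v)" by simp
    also have "\<dots> \<le> 6" using tmv by simp
    finally show ?thesis .
  qed
  then have "exp (- 6) \<le> q ^ (3 * \<tau> * m)" using q by (simp add: power_eq_exp_ln)
  moreover have "1 / 729 \<le> exp (- 6 :: real)"
  proof -
    have "exp (6::real) = exp 1 ^ 6" by (simp add: exp_of_nat_mult[symmetric])
    also have "\<dots> \<le> 3 ^ 6" using exp_le by (intro power_mono) auto
    finally show ?thesis by (simp add: exp_minus field_simps)
  qed
  ultimately have qp: "1 / 729 \<le> q ^ (3 * \<tau> * m)" by linarith
  define x where "x = real \<tau> * (v * q ^ (3 * \<tau> * m))"
  have x0: "0 \<le> x" using v q by (simp add: x_def)
  have x1: "x \<le> 1"
  proof -
    have "real \<tau> * v \<le> real \<tau> * real m * v" using m v by (intro mult_right_mono) (auto simp: mult_le_cancel_left1)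
    then have "real \<tau> * v \<le> 1" using tmv by linarith
    moreover have "q ^ (3 * \<tau> * m) \<le> 1" using q by (intro power_le_one) auto
    ultimately have "real \<tau> * v * q ^ (3 * \<tau> * m) \<le> 1 * 1" using v q by (intro mult_mono) auto
    then show ?thesis by (simp add: x_def mult.assoc)
  qed
  have s: "\<sigma> = 1 - (1 - x) ^ \<tau>" by (simp add: \<sigma>_def x_def v_def)
  show "\<sigma> \<le> 1" using x1 by (simp add: s)
  have "1 / (3000 * (real m)\<^sup>2 * v) \<le> real \<tau> * x"
  proof -
    \<comment> \<open>Rounding costs a factor 4 and the geometric decay a factor 729;
      \<open>4 * 729 = 2916 \<le> 3000\<close>.\<close>
    have "1 / (3000 * (real m)\<^sup>2 * v) \<le> (z / 2)\<^sup>2 * v * (1 / 729)"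
      using v m by (simp add: z_def field_simps power2_eq_square)
    also have "\<dots> \<le> (real \<tau>)\<^sup>2 * v * q ^ (3 * \<tau> * m)"
      using tz z v qp by (intro mult_mono power_mono) auto
    finally show ?thesis by (simp add: x_def power2_eq_square mult_ac)
  qed
  then have "min 1 (1 / (3000 * (real m)\<^sup>2 * v)) / 2 \<le> min 1 (real \<tau> * x) / 2" by simp
  also have "\<dots> \<le> \<sigma>" unfolding s by (rule min_le_one_minus_power[OF x0 x1])
  finally show "min 1 (1 / (3000 * (real m)\<^sup>2 * (1 - q))) / 2 \<le> \<sigma>" by (simp add: v_def)
qed

text \<open>With \<open>m\<close> blocks, \<open>m\<close> between \<open>w\<close> and
  \<open>2 w\<close> for \<open>w = 1 / (200 * sqrt v)\<close>, one has
  \<open>3000 m^2 v \<le> 1\<close>, so each block succeeds with probability at least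
  \<open>1 / 2\<close>. If \<open>w \<le> 1\<close>, the trivial lower bound 1 is enough.\<close>

lemma expected_LDS_ge_sqrt:
  assumes n: "2 \<le> n" and q: "0 < q" "q < 1" and r: "q \<le> 1 - 4 / real n"
  shows "1 / 400 * (1 / sqrt (1 - q)) \<le> expected_LDS n q"
proof -
  define v where "v = 1 - q"
  have v: "0 < v" "v < 1" "4 / real n \<le> v" using q r by (auto simp: v_def)
  have E1: "1 \<le> expected_LDS n q" using n q by (intro expected_LDS_ge_1) auto
  show ?thesis
  proof (cases "1 / 200 * (1 / sqrt v) \<le> 1")
    case True
    then show ?thesis using E1 by (simp add: v_def)
  next
    case False
    define w where "w = 1 / 200 * (1 / sqrt v)"
    have w: "1 < w" using False by (simp add: w_def)
    have "200 * sqrt v < 1" using False v by (simp add: field_simps)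
    then have sv: "sqrt v < 1 / 200" by simp
    have vs: "v = sqrt v * sqrt v" using v by simp
    have "sqrt v * sqrt v \<le> 1 / 200 * (1 / 200)" using sv v by (intro mult_mono) auto
    then have vh: "v \<le> 1 / 40000" using vs by simp
    define m where "m = nat \<lceil>w\<rceil>"
    have m: "w \<le> real m" "real m \<le> w + 1" unfolding m_def using nat_ceiling_bounds[of w] w by auto
    have m1: "1 \<le> m" using m w by linarith
    have m2: "real m \<le> 1 / 100 * (1 / sqrt v)" using m w by (simp add: w_def)
    have mv: "real m * sqrt v \<le> 1 / 100" using m2 v by (simp add: field_simps)
    have mv1: "real m * v \<le> 1"
    proof -
      have "real m * v = real m * sqrt v * sqrt v" using v by simp
      also have "\<dots> \<le> 1 / 100 * 1" using mv sv v by (intro mult_mono) auto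
      finally show ?thesis by simp
    qed
    have mv2: "3000 * (real m)\<^sup>2 * v \<le> 1"
    proof -
      have "(real m * sqrt v)\<^sup>2 \<le> (1 / 100)\<^sup>2" using mv v by (intro power_mono) auto
      then show ?thesis using v by (simp add: power_mult_distrib power_divide)
    qed
    define \<tau> where "\<tau> = nat \<lfloor>1 / (real m * (1 - q))\<rfloor>"
    define \<sigma> where "\<sigma> = 1 - (1 - real \<tau> * ((1 - q) * q ^ (3 * \<tau> * m))) ^ \<tau>"
    have "1 / 2 \<le> q" using vh by (simp add: v_def)
    note pl = planting_probability[OF this q(2) m1 mv1[unfolded v_def], folded \<tau>_def, folded \<sigma>_def]
    have "0 < (real m)\<^sup>2 * v" using m1 v by simp
    then have "1 \<le> 1 / (3000 * (real m)\<^sup>2 * v)" using mv2 by (subst pos_le_divide_eq) (auto simp: mult.commute)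
    then have s: "1 / 2 \<le> \<sigma>" using pl(4) by (simp add: v_def)
    \<comment> \<open>A single run with its offset takes \<open>4 * \<tau> * m\<close> positions;
      they fit because \<open>q \<le> 1 - 4 / n\<close>.\<close>
    have "real (\<tau> * m) * 4 \<le> 1 / v * 4" using pl(2) by (simp add: v_def)
    also have "\<dots> \<le> real n" using v n by (simp add: field_simps)
    finally have "real (4 * (\<tau> * m)) \<le> real n" by simp
    then have "(3 + 1) * \<tau> * m \<le> n" by (simp only: of_nat_le_iff) simp
    then have "real m * \<sigma> \<le> expected_LDS n q" unfolding \<sigma>_def using q by (intro expected_LDS_lower(1)[where g = 1]) auto
    moreover have "w * (1 / 2) \<le> real m * \<sigma>" using m w s by (intro mult_mono) auto
    ultimately show ?thesis by (simp add: w_def v_def)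
  qed
qed

text \<open>A run has length \<open>\<tau> * m \<le> (ln n)^2\<close>, so at least
  \<open>exp (ln n / 4)\<close> runs fit; the 4 in \<open>large\<close> pays for the offset and for
  rounding. As \<open>\<sigma> ^ m \<ge> exp (- ln n / 4)\<close>, some run succeeds completely with
  probability at least \<open>1 / 2\<close>.\<close>

lemma expected_LDS_ge_half:
  fixes m n \<tau> :: nat and q :: real
  assumes q: "0 < q" "q < 1" and n: "2 \<le> n" and L: "1 \<le> ln n"
    and large: "exp (ln n / 4) \<le> real n / (ln n)\<^sup>2 - 4"
    and m: "1 \<le> m" and \<tau>: "1 \<le> \<tau>" "real (\<tau> * m) \<le> (ln n)\<^sup>2"
  defines "\<sigma> \<equiv> 1 - (1 - real \<tau> * ((1 - q) * q ^ (3 * \<tau> * m))) ^ \<tau>"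
  assumes \<sigma>: "0 \<le> \<sigma>" "\<sigma> \<le> 1" "exp (- (ln n / 4)) \<le> \<sigma> ^ m"
  shows "real m / 2 \<le> expected_LDS n q"
proof -
  define k where "k = \<tau> * m"
  have k: "0 < k" using m \<tau> by (simp add: k_def)
  define g where "g = n div k - 3"
  have "real n / (ln n)\<^sup>2 \<le> real n / real k"
    using \<tau> k L by (intro divide_left_mono mult_pos_pos) (auto simp: k_def)
  moreover have "real n / real k < real (n div k) + 1"
  proof -
    have "n < Suc (n div k) * k" using k by (simp add: dividend_less_div_times)
    then have "real n < real (Suc (n div k) * k)" by (simp only: of_nat_less_iff)
    then show ?thesis using k by (simp add: field_simps)
  qed
  ultimately have "exp (ln n / 4) + 3 \<le> real (n div k)" using large by linarith
  moreover have "0 \<le> exp (ln n / 4)" by simp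
  ultimately have "3 \<le> n div k" by linarith
  then have g: "3 + g = n div k" by (simp add: g_def)
  then have ng: "(3 + g) * \<tau> * m \<le> n" by (simp add: k_def mult.assoc)
  have "real (3 + g) = real (n div k)" using g by simp
  then have ge: "exp (ln n / 4) \<le> real g" using \<open>exp (ln n / 4) + 3 \<le> real (n div k)\<close> by simp
  define y where "y = \<sigma> ^ m"
  have y: "0 \<le> y" "y \<le> 1" using \<sigma> by (auto simp: y_def power_le_one)
  have "exp (ln n / 4) * exp (- (ln n / 4)) \<le> real g * y"
    using ge \<sigma> by (intro mult_mono) (auto simp: y_def)
  then have "1 \<le> real g * y" by (simp add: exp_add[symmetric])
  then have "1 / 2 \<le> 1 - (1 - y) ^ g" using min_le_one_minus_power[OF y, of g] by simp
  then have "real m * (1 / 2) \<le> real m * (1 - (1 - y) ^ g)" by (intro mult_left_mono) auto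
  also have "\<dots> \<le> expected_LDS n q"
    using expected_LDS_lower(2)[OF q ng] \<sigma>(1) unfolding y_def \<sigma>_def by blast
  finally show ?thesis by simp
qed

text \<open>Blocks of a single position: \<open>\<sigma> ^ m = (1 - q) ^ m * q ^ (3 m^2)\<close>.
  Each of the last two conditions on \<open>m\<close> limits one factor to a loss of
  \<open>exp (- ln n / 8)\<close>.\<close>

lemma expected_LDS_ge_half_runs:
  fixes m n :: nat and q :: real
  assumes q: "0 < q" "q < 1" and n: "2 \<le> n" and L: "1 \<le> ln (ln n)"
    and large: "exp (ln n / 4) \<le> real n / (ln n)\<^sup>2 - 4"
    and v: "1 / ln n \<le> 1 - q" and m: "1 \<le> m" "8 * real m * ln (ln n) \<le> ln n" "24 * (real m)\<^sup>2 * ln (1 / q) \<le> ln n"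
  shows "real m / 2 \<le> expected_LDS n q"
proof (rule expected_LDS_ge_half[where \<tau> = 1])
  have L0: "0 < ln n" using n by simp
  have "ln (ln n) \<le> ln n" using ln_le_minus_one[OF L0] by linarith
  then show L1: "1 \<le> ln n" using L by linarith
  have "8 * real m * 1 \<le> 8 * real m * ln (ln n)" using L by (intro mult_left_mono) auto
  then have "real m \<le> ln n" using m by linarith
  also have "\<dots> \<le> (ln n)\<^sup>2" using L1 by (simp add: power2_eq_square)
  finally show "real (1 * m) \<le> (ln n)\<^sup>2" by simp
  have q1: "q ^ (3 * 1 * m) \<le> 1" using q by (intro power_le_one) auto
  then show "1 - (1 - real 1 * ((1 - q) * q ^ (3 * 1 * m))) ^ 1 \<le> 1"
    using q mult_mono[of "1 - q" 1 "q ^ (3 * m)" 1] by simp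
  show "0 \<le> 1 - (1 - real 1 * ((1 - q) * q ^ (3 * 1 * m))) ^ 1" using q by simp
  have "ln (1 / ln n) \<le> ln (1 - q)" using v L0 by (intro ln_mono) auto
  then have "- ln (1 - q) \<le> ln (ln n)" using L0 by (simp add: ln_div)
  then have "real m * - ln (1 - q) \<le> real m * ln (ln n)" by (intro mult_left_mono) auto
  then have "- (ln n / 4) \<le> real m * ln (1 - q) + real (3 * m * m) * ln q"
    using m q by (simp add: ln_div power2_eq_square)
  then have "exp (- (ln n / 4)) \<le> exp (real m * ln (1 - q)) * exp (real (3 * m * m) * ln q)"
    unfolding exp_add[symmetric] by simp
  also have "\<dots> = ((1 - q) * q ^ (3 * m)) ^ m"
    using q by (simp add: power_eq_exp_ln[symmetric] power_mult_distrib power_mult[symmetric] del: of_nat_mult)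
  finally show "exp (- (ln n / 4)) \<le> (1 - (1 - real 1 * ((1 - q) * q ^ (3 * 1 * m))) ^ 1) ^ m" by simp
qed (use assms in auto)

lemma expected_LDS_ge_sqrt_log:
  fixes n :: nat and q :: real
  assumes n: "2 \<le> n" and q: "0 < q" "q < 1" and L: "1 \<le> ln (ln n)"
    and large: "exp (ln n / 4) \<le> real n / (ln n)\<^sup>2 - 4"
    and r: "(ln (ln n))\<^sup>2 / ln n \<le> 1 - q"
  shows "1 / 400 * sqrt (ln n / ln (1 / q)) \<le> expected_LDS n q"
proof -
  define b where "b = sqrt (ln n / ln (1 / q))"
  have E1: "1 \<le> expected_LDS n q" using n q by (intro expected_LDS_ge_1) auto
  have L0: "0 < ln n" using n by simp
  have lq: "1 - q \<le> ln (1 / q)" using q by (intro ln_inverse_ge)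
  have bsq: "b\<^sup>2 * ln (1 / q) = ln n" using lq q L0 by (simp add: b_def)
  have bL: "b * ln (ln n) \<le> ln n"
    using sqrt_div_mult_ln_le[OF L0, of "ln (1 / q)"] lq q r L by (simp add: b_def)
  show ?thesis
  proof (cases "1 / 200 * b \<le> 1")
    case True
    then show ?thesis using E1 by (simp add: b_def)
  next
    case False
    define m where "m = nat \<lceil>1 / 200 * b\<rceil>"
    have m: "1 / 200 * b \<le> real m" "real m \<le> 1 / 200 * b + 1"
      unfolding m_def using nat_ceiling_bounds[of "1 / 200 * b"] False by auto
    have m2: "real m \<le> 1 / 100 * b" using m False by linarith
    have "real m / 2 \<le> expected_LDS n q"
    proof (rule expected_LDS_ge_half_runs[OF q n L large])
      have "1 / ln n \<le> (ln (ln n))\<^sup>2 / ln n" using L L0 by (intro divide_right_mono) auto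
      then show "1 / ln n \<le> 1 - q" using r by linarith
      show "1 \<le> m" using m False by linarith
      have "8 * real m * ln (ln n) \<le> 8 * (1 / 100 * b) * ln (ln n)" using m2 L by (intro mult_right_mono) auto
      also have "\<dots> = 8 / 100 * (b * ln (ln n))" by simp
      also have "\<dots> \<le> ln n" using bL L0 by linarith
      finally show "8 * real m * ln (ln n) \<le> ln n" .
      have "(real m)\<^sup>2 \<le> (1 / 100 * b)\<^sup>2" using m2 by (intro power_mono) auto
      then have "24 * (real m)\<^sup>2 * ln (1 / q) \<le> 24 * (1 / 100 * b)\<^sup>2 * ln (1 / q)"
        using lq q by (intro mult_right_mono mult_left_mono) auto
      also have "\<dots> = 24 / 10000 * (b\<^sup>2 * ln (1 / q))" by (simp add: power_mult_distrib power_divide)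
      also have "\<dots> \<le> ln n" using bsq L0 by simp
      finally show "24 * (real m)\<^sup>2 * ln (1 / q) \<le> ln n" .
    qed
    then show ?thesis using m by (simp add: b_def)
  qed
qed

text \<open>The case split is at \<open>v = 1 / ln n\<close>. Above it \<open>y \<ge> ln n\<close>,
  so \<open>b * ln (ln n) \<le> ln n\<close> and single-position blocks suffice. Below it longer
  blocks fit, with \<open>\<sigma> \<ge> 1 / y\<close>, and \<open>m * ln y\<close> is a small
  fraction of \<open>ln n\<close>.\<close>

lemma expected_LDS_ge_log:
  fixes n :: nat and q :: real
  assumes n: "2 \<le> n" and q: "0 < q" "q < 1" and L: "1 \<le> ln (ln n)"
    and large: "exp (ln n / 4) \<le> real n / (ln n)\<^sup>2 - 4"
    and half: "(ln (ln n))\<^sup>2 / ln n \<le> 1 / 2"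
    and r: "1 - (ln (ln n))\<^sup>2 / ln n \<le> q" "q \<le> 1 - 3 / (ln n)\<^sup>2"
  shows "1 / 400 * (ln n / ln ((1 - q) * (ln n)\<^sup>2)) \<le> expected_LDS n q"
proof -
  define v y where "v = 1 - q" and "y = v * (ln n)\<^sup>2"
  define b where "b = ln n / ln y"
  have E1: "1 \<le> expected_LDS n q" using n q by (intro expected_LDS_ge_1) auto
  have L0: "0 < ln n" using n by simp
  have L1: "1 \<le> ln n" using ln_le_minus_one[OF L0] L by linarith
  have v: "0 < v" "v \<le> (ln (ln n))\<^sup>2 / ln n" "3 / (ln n)\<^sup>2 \<le> v" using q r by (auto simp: v_def)
  have qh: "1 / 2 \<le> q" using v(2) half unfolding v_def by linarith
  have y: "3 \<le> y" using v L0 by (simp add: y_def field_simps)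
  have lny: "1 \<le> ln y" using y ln_3_ge_1 ln_mono[of 3 y] by linarith
  have by_L: "b * ln y = ln n" using lny by (simp add: b_def)
  have b0: "0 < b" using L0 lny by (simp add: b_def)
  show ?thesis
  proof (cases "1 / 200 * b \<le> 1")
    case True
    then show ?thesis using E1 by (simp add: b_def y_def v_def)
  next
    case False
    define m where "m = nat \<lceil>1 / 200 * b\<rceil>"
    have m: "1 / 200 * b \<le> real m" "real m \<le> 1 / 200 * b + 1"
      unfolding m_def using nat_ceiling_bounds[of "1 / 200 * b"] False by auto
    have m1: "1 \<le> m" using m False by linarith
    have m2: "real m \<le> 1 / 100 * b" using m False by linarith
    have msq: "(real m)\<^sup>2 \<le> b\<^sup>2 / 10000"
      using power_mono[OF m2, of 2] by (simp add: power_mult_distrib power_divide)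
    have "real m / 2 \<le> expected_LDS n q"
    proof (cases "1 / ln n \<le> v")
      case True
      have "ln n = 1 / ln n * (ln n)\<^sup>2" using L0 by (simp add: power2_eq_square)
      also have "\<dots> \<le> y" unfolding y_def using True by (intro mult_right_mono) auto
      finally have "ln (ln n) \<le> ln y" using L0 by (intro ln_mono) auto
      then have bL: "b * ln (ln n) \<le> ln n" using by_L b0 mult_left_mono[of "ln (ln n)" "ln y" b] by simp
      show ?thesis
      proof (rule expected_LDS_ge_half_runs[OF q n L large True[unfolded v_def] m1])
        have "8 * real m * ln (ln n) \<le> 8 * (1 / 100 * b) * ln (ln n)" using m2 L by (intro mult_right_mono) auto
        also have "\<dots> = 8 / 100 * (b * ln (ln n))" by simp
        also have "\<dots> \<le> ln n" using bL L0 by linarith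
        finally show "8 * real m * ln (ln n) \<le> ln n" .
        have "24 * (real m)\<^sup>2 * ln (1 / q) \<le> 24 * (b\<^sup>2 / 10000) * (2 * ((ln (ln n))\<^sup>2 / ln n))"
        proof (intro mult_mono)
          show "ln (1 / q) \<le> 2 * ((ln (ln n))\<^sup>2 / ln n)"
            using ln_inverse_le[OF qh q(2)] v by (simp add: v_def)
        qed (use msq q in auto)
        also have "\<dots> = 48 / 10000 * ((b * ln (ln n))\<^sup>2 / ln n)" by (simp add: power_mult_distrib)
        also have "\<dots> \<le> 48 / 10000 * ((ln n)\<^sup>2 / ln n)"
          using bL b0 L L0 L1 by (intro mult_left_mono divide_right_mono power_mono mult_nonneg_nonneg) auto
        also have "\<dots> \<le> ln n" using L0 by (simp add: power2_eq_square)
        finally show "24 * (real m)\<^sup>2 * ln (1 / q) \<le> ln n" .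
      qed
    next
      case False
      then have vL: "v < 1 / ln n" by simp
      have bln: "b \<le> ln n" using by_L b0 lny mult_left_mono[of 1 "ln y" b] by simp
      have "real m * v \<le> 1 / 100 * ln n * (1 / ln n)"
        using m2 bln vL v L0 by (intro mult_mono) auto
      then have mv1: "real m * (1 - q) \<le> 1" using L0 by (simp add: v_def)
      define \<tau> where "\<tau> = nat \<lfloor>1 / (real m * (1 - q))\<rfloor>"
      define \<sigma> where "\<sigma> = 1 - (1 - real \<tau> * ((1 - q) * q ^ (3 * \<tau> * m))) ^ \<tau>"
      note pl = planting_probability[OF qh q(2) m1 mv1, folded \<tau>_def, folded \<sigma>_def]
      have sy: "1 / y \<le> \<sigma>"
      proof -
        \<comment> \<open>\<open>m \<le> b / 100\<close> gives
          \<open>6000 m^2 \<le> (ln n)^2\<close>; the 6000 is the 3000 of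
          \<open>planting_probability\<close> doubled by its final halving.\<close>
        have "b\<^sup>2 \<le> (ln n)\<^sup>2" using bln b0 by (intro power_mono) auto
        then have "6000 * (real m)\<^sup>2 \<le> (ln n)\<^sup>2" using msq zero_le_power2[of "real m"] by linarith
        then have "6000 * (real m)\<^sup>2 * v \<le> y"
          unfolding y_def mult.commute[of v] using v by (intro mult_right_mono) auto
        moreover have "0 < (real m)\<^sup>2 * v" using m1 v by simp
        ultimately have "1 / y \<le> 1 / (6000 * (real m)\<^sup>2 * v)" using y by (intro divide_left_mono) (auto simp: mult.assoc)
        moreover have "1 / y \<le> 1 / 2" using y by simp
        moreover have "1 / (6000 * (real m)\<^sup>2 * v) = 1 / (3000 * (real m)\<^sup>2 * v) / 2" by simp
        ultimately have "1 / y \<le> min 1 (1 / (3000 * (real m)\<^sup>2 * v)) / 2" by (simp add: min_def)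
        then show ?thesis using pl(4) unfolding v_def by linarith
      qed
      show ?thesis
      proof (rule expected_LDS_ge_half[OF q n L1 large m1 pl(1), folded \<sigma>_def])
        have "1 / v \<le> (ln n)\<^sup>2" using v L0 y by (simp add: y_def field_simps)
        then show "real (\<tau> * m) \<le> (ln n)\<^sup>2" using pl(2) by (simp add: v_def)
        show "0 \<le> \<sigma>" using sy y by (simp add: order_trans[OF _ sy])
        show "\<sigma> \<le> 1" by (rule pl(3))
        have "real m * ln y \<le> 1 / 100 * b * ln y" using m2 lny by (intro mult_right_mono) auto
        also have "\<dots> \<le> ln n / 4" using by_L L0 by simp
        finally have "exp (- (ln n / 4)) \<le> exp (- (real m * ln y))" by simp
        also have "\<dots> = (1 / y) ^ m" using y by (simp add: power_eq_exp_ln ln_div)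
        also have "\<dots> \<le> \<sigma> ^ m" using sy y by (intro power_mono) auto
        finally show "exp (- (ln n / 4)) \<le> \<sigma> ^ m" .
      qed
    qed
    then show ?thesis using m by (simp add: b_def y_def v_def)
  qed
qed

section \<open>Small \<open>n\<close> and uniform constants\<close>

lemma eventually_large:
  "\<exists>N. \<forall>n\<ge>N. 1 \<le> ln (ln (real n)) \<and> exp (ln (real n) / 4) \<le> real n / (ln (real n))\<^sup>2 - 4 \<and>
      (ln (ln (real n)))\<^sup>2 / ln (real n) \<le> 1 / 2"
proof -
  have "\<forall>\<^sub>F n::nat in sequentially. 1 \<le> ln (ln (real n))" by real_asymp
  moreover have "\<forall>\<^sub>F n::nat in sequentially. exp (ln (real n) / 4) \<le> real n / (ln (real n))\<^sup>2 - 4" by real_asymp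
  moreover have "\<forall>\<^sub>F n::nat in sequentially. (ln (ln (real n)))\<^sup>2 / ln (real n) \<le> 1 / 2" by real_asymp
  ultimately show ?thesis unfolding eventually_sequentially[symmetric] by (intro eventually_conj)
qed

text \<open>\<open>exp 1\<close> lies strictly between 2 and 3. Hence \<open>ln (ln n)\<close> is
  nonzero, which keeps \<open>q\<close> away from 1 in the third range for each fixed
  \<open>n\<close>.\<close>

lemma ln_nat_neq_1: "ln (real n) \<noteq> 1"
proof
  assume *: "ln (real n) = 1"
  then have "0 < n" by (cases "n = 0") auto
  with * have e: "real n = exp 1" by (metis exp_ln of_nat_0_less_iff)
  show False
  proof (cases "n \<le> 2")
    case True
    then have "ln (real n) \<le> ln 2" using \<open>0 < n\<close> by (intro ln_mono) auto
    then show False using * ln_2_less_1 by simp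
  next
    case False
    then show False using e e_less_272 by simp
  qed
qed

theorem theorem1p5:
  shows "\<exists>C0 c1 c C :: real. C0 > 0 \<and> c1 > 0 \<and> 0 < c \<and> c \<le> C \<and>
    (\<forall>(n::nat) (q::real). n \<ge> 2 \<and> 0 < q \<and> q < 1 \<longrightarrow>
      ((1 - C0 / (ln n)^2 \<le> q \<and> q \<le> 1 - 4 / real n \<longrightarrow>
          c * (1 / sqrt (1 - q)) \<le> expected_LDS n q \<and>
          expected_LDS n q \<le> C * (1 / sqrt (1 - q))) \<and>
       (1 - c1 * (ln (ln n))^2 / ln n \<le> q \<and> q \<le> 1 - C0 / (ln n)^2 \<longrightarrow>
          c * (ln n / ln ((1 - q) * (ln n)^2)) \<le> expected_LDS n q \<and>
          expected_LDS n q \<le> C * (ln n / ln ((1 - q) * (ln n)^2))) \<and>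
       (1 / real n \<le> q \<and> q \<le> 1 - c1 * (ln (ln n))^2 / ln n \<longrightarrow>
          c * sqrt (ln n / ln (1 / q)) \<le> expected_LDS n q \<and>
          expected_LDS n q \<le> C * sqrt (ln n / ln (1 / q))) \<and>
       (q \<le> 1 / real n \<longrightarrow>
          c * (real n * q) \<le> expected_LDS n q - 1 \<and>
          expected_LDS n q - 1 \<le> C * (real n * q))))"
proof -
  obtain N where N: "\<And>n. N \<le> n \<Longrightarrow> 1 \<le> ln (ln (real n))"
    "\<And>n. N \<le> n \<Longrightarrow> exp (ln (real n) / 4) \<le> real n / (ln (real n))\<^sup>2 - 4"
    "\<And>n. N \<le> n \<Longrightarrow> (ln (ln (real n)))\<^sup>2 / ln (real n) \<le> 1 / 2"
    using eventually_large by blast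
  \<comment> \<open>For the finitely many \<open>n\<close> below \<open>N\<close>, \<open>M\<close>
    dominates the comparison functions of the second and third ranges, at most \<open>ln n\<close>
    and \<open>ln n / \<bar>ln (ln n)\<bar>\<close> there. With \<open>c = 1 / M\<close> their lower
    bounds reduce to the trivial bound 1; the entry 400 makes
    \<open>c \<le> 1 / 400\<close>.\<close>
  define M where "M = Max (insert 400 ((\<lambda>n. ln (real n) * max 1 (1 / \<bar>ln (ln (real n))\<bar>)) ` {..N}))"
  have M: "400 \<le> M" unfolding M_def by (intro Max_ge) auto
  have MN: "ln (real n) * max 1 (1 / \<bar>ln (ln (real n))\<bar>) \<le> M" if "n < N" for n
    unfolding M_def using that by (intro Max_ge) auto
  define c where "c = 1 / M"
  have c: "0 < c" "c \<le> 1 / 400" using M by (auto simp: c_def field_simps)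
  have weaken: "c * x \<le> E" if "1 / 400 * x \<le> E" "0 \<le> x" for x E
    using that c mult_right_mono[of c "1 / 400" x] by linarith
  have small: "c * x \<le> expected_LDS n q" if "x \<le> M" "2 \<le> n" "0 < q" for x n q
  proof -
    have "c * x \<le> c * M" using that c by (intro mult_left_mono) auto
    also have "\<dots> = 1" using M by (simp add: c_def)
    also have "\<dots> \<le> expected_LDS n q" using that by (intro expected_LDS_ge_1) auto
    finally show ?thesis .
  qed
  have scale: "E \<le> 52 * x" if "E \<le> k * x" "k \<le> 52" "0 \<le> x" for E k x :: real
    using that mult_right_mono[of k 52 x] by linarith
  have main: "(1 - 3 / (ln n)^2 \<le> q \<and> q \<le> 1 - 4 / real n \<longrightarrow>
          c * (1 / sqrt (1 - q)) \<le> expected_LDS n q \<and>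
          expected_LDS n q \<le> 52 * (1 / sqrt (1 - q))) \<and>
       (1 - 1 * (ln (ln n))^2 / ln n \<le> q \<and> q \<le> 1 - 3 / (ln n)^2 \<longrightarrow>
          c * (ln n / ln ((1 - q) * (ln n)^2)) \<le> expected_LDS n q \<and>
          expected_LDS n q \<le> 52 * (ln n / ln ((1 - q) * (ln n)^2))) \<and>
       (1 / real n \<le> q \<and> q \<le> 1 - 1 * (ln (ln n))^2 / ln n \<longrightarrow>
          c * sqrt (ln n / ln (1 / q)) \<le> expected_LDS n q \<and>
          expected_LDS n q \<le> 52 * sqrt (ln n / ln (1 / q))) \<and>
       (q \<le> 1 / real n \<longrightarrow>
          c * (real n * q) \<le> expected_LDS n q - 1 \<and>
          expected_LDS n q - 1 \<le> 52 * (real n * q))"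
    if n: "2 \<le> n" and q: "0 < q" "q < 1" for n :: nat and q :: real
  proof (intro conjI impI; (elim conjE)?)
    have L: "0 < ln n" using n by simp
    have lq: "1 - q \<le> ln (1 / q)" using q by (intro ln_inverse_ge)
    {
      assume r: "1 - 3 / (ln n)^2 \<le> q" "q \<le> 1 - 4 / real n"
      show "c * (1 / sqrt (1 - q)) \<le> expected_LDS n q"
        using q by (intro weaken expected_LDS_ge_sqrt n r) auto
      show "expected_LDS n q \<le> 52 * (1 / sqrt (1 - q))"
        using q by (intro scale[OF expected_LDS_le_sqrt] n r) auto
    next
      assume r: "1 - 1 * (ln (ln n))^2 / ln n \<le> q" "q \<le> 1 - 3 / (ln n)^2"
      have y: "3 \<le> (1 - q) * (ln n)^2" using r L by (simp add: field_simps)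
      have lny: "1 \<le> ln ((1 - q) * (ln n)^2)"
        using y ln_3_ge_1 ln_mono[of 3 "(1 - q) * (ln n)^2"] by linarith
      show "c * (ln n / ln ((1 - q) * (ln n)^2)) \<le> expected_LDS n q"
      proof (cases "N \<le> n")
        case True
        have "0 \<le> ln n / ln ((1 - q) * (ln n)^2)" using L lny by simp
        then show ?thesis
          using r by (intro weaken expected_LDS_ge_log[OF n q N(1)[OF True] N(2)[OF True] N(3)[OF True]]) simp_all
      next
        case False
        have "ln n / ln ((1 - q) * (ln n)^2) \<le> ln n / 1" using lny L by (intro divide_left_mono) auto
        also have "\<dots> \<le> ln n * max 1 (1 / \<bar>ln (ln n)\<bar>)" using L by simp
        also have "\<dots> \<le> M" using False by (intro MN) auto
        finally show ?thesis using n q by (intro small) auto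
      qed
      show "expected_LDS n q \<le> 52 * (ln n / ln ((1 - q) * (ln n)^2))"
        using q by (intro expected_LDS_le_log n r) auto
    next
      assume r: "1 / real n \<le> q" "q \<le> 1 - 1 * (ln (ln n))^2 / ln n"
      have nn: "0 \<le> sqrt (ln n / ln (1 / q))" using L lq q by simp
      show "c * sqrt (ln n / ln (1 / q)) \<le> expected_LDS n q"
      proof (cases "N \<le> n")
        case True
        then show ?thesis using n q r N[OF True] nn by (intro weaken expected_LDS_ge_sqrt_log) auto
      next
        case False
        have ll: "0 < \<bar>ln (ln n)\<bar>" using ln_nat_neq_1[of n] L by simp
        have "(ln (ln n))\<^sup>2 / ln n \<le> ln (1 / q)" using r lq by linarith
        then have "sqrt (ln n / ln (1 / q)) * \<bar>ln (ln n)\<bar> \<le> ln n"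
          using L lq q by (intro sqrt_div_mult_ln_le) auto
        then have "sqrt (ln n / ln (1 / q)) \<le> ln n * (1 / \<bar>ln (ln n)\<bar>)"
          using ll by (simp add: pos_le_divide_eq)
        also have "\<dots> \<le> ln n * max 1 (1 / \<bar>ln (ln n)\<bar>)" using L by (intro mult_left_mono) auto
        also have "\<dots> \<le> M" using False by (intro MN) auto
        finally show ?thesis using n q by (intro small) auto
      qed
      show "expected_LDS n q \<le> 52 * sqrt (ln n / ln (1 / q))"
        using nn by (intro scale[OF expected_LDS_le_sqrt_log] n q r) auto
    next
      assume r: "q \<le> 1 / real n"
      then have nq: "real n * q \<le> 1" using n by (simp add: field_simps)
      have "c * (real n * q) \<le> 1 / 4 * (real n * q)" using c q by (intro mult_right_mono) auto
      then show "c * (real n * q) \<le> expected_LDS n q - 1"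
        using expected_LDS_lower_small[OF q n nq] by simp
      have "1 * (real n * q) \<le> 52 * (real n * q)" using q by (intro mult_right_mono) auto
      then show "expected_LDS n q - 1 \<le> 52 * (real n * q)"
        using expected_LDS_upper_small[OF q, of n] by linarith
    }
  qed
  \<comment> \<open>\<open>C0 = 3\<close> keeps the logarithm in the second range at least
    \<open>ln 3 \<ge> 1\<close>; \<open>52\<close> is the largest of the three upper
    constants.\<close>
  show ?thesis
    by (rule exI[of _ 3], rule exI[of _ 1], rule exI[of _ c], rule exI[of _ 52]) (use c main in auto)
qed

end
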